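(* Let $p\in(0,1)$, and let $(\mathcal{G}_x)_{x\in\mathbb{Z}^2}$ be i.i.d. with $\mathcal{G}_x=\{e_1,-e_1,-e_2\}$ with probability $p$ and $\mathcal{G}_x=\{-e_2\}$ with probability $1-p$. Then the random walk $(X_n)$ in the associated uniform random environment, started at the origin, satisfies $P(n^{-1}X_n\to v)=1$ for a deterministic $v=(v^{[1]},v^{[2]})$ with $v^{[1]}=0$, $v^{[2]}\neq 0$ and $$\frac{1}{v^{[2]}}=\frac{8p(1-p)}{1+\sqrt5}-1-2p-\frac{4(1-p)^2(5+\sqrt5)}{p(1+\sqrt5)}\sum_{k=2}^{\infty}\frac{p^k}{1+2^{-k}(3+\sqrt5)^k}.$$
   Context: $e_1=(1,0)$ and $e_2=(0,1)$ are the unit vectors of $\mathbb{Z}^2$. Given a realization of the i.i.d. non-empty sets $(\mathcal{G}_x)_{x\in\mathbb{Z}^2}$, each a subset of $\{\pm e_1,\pm e_2\}$, the walk in the associated uniform random environment is the time-homogeneous Markov chain $(X_n)_{n\ge0}$ on $\mathbb{Z}^2$ with $X_0=0$ that moves from $x$ to $x+e$ with probability $1/|\mathcal{G}_x|$ if $e\in\mathcal{G}_x$, and with probability $0$ otherwise. The environment is sampled once and kept fixed. $P$ denotes the annealed law, i.e. the law of the walk averaged over the environment. *)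

theory Defs
  imports "HOL-Probability.Probability"
begin

type_synonym site = "int \<times> int"

type_synonym environment = "site \<Rightarrow> site set"

abbreviation e1 :: site where "e1 \<equiv> (1, 0)"

abbreviation e2 :: site where "e2 \<equiv> (0, 1)"

text \<open>
  An environment assigns to each site \<open>x\<close> the set \<open>G x\<close> of allowed steps.
  \<^const>\<open>pmf_of_set\<close> is unspecified unless \<open>G x\<close> is finite and non-empty.
\<close>

definition step_pmf :: "environment \<Rightarrow> site \<Rightarrow> site pmf" where
  "step_pmf G x = map_pmf (\<lambda>e. x + e) (pmf_of_set (G x))"

text \<open>
  \<open>walk_kernel G n X\<close> is the conditional law of the position at time \<open>n\<close>, given the positions
  \<open>X 0, \<dots>, X (n - 1)\<close>.
\<close>

fun walk_kernel :: "environment \<Rightarrow> nat \<Rightarrow> (nat \<Rightarrow> site) \<Rightarrow> site measure" where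
  "walk_kernel G 0 X = measure_pmf (return_pmf 0)"
| "walk_kernel G (Suc n) X = measure_pmf (step_pmf G (X n))"

lemma Ionescu_Tulcea_walk_kernel:
  "Ionescu_Tulcea (walk_kernel G) (\<lambda>_. count_space UNIV)"
proof (rule Ionescu_Tulcea.intro)
  fix n :: nat
  show "walk_kernel G n \<in> measurable (PiM {0..<n} (\<lambda>_. count_space UNIV)) (subprob_algebra (count_space UNIV))"
  proof (cases n)
    case 0
    have "walk_kernel G 0 = (\<lambda>_. measure_pmf (return_pmf 0))" by (rule ext) simp
    then show ?thesis using 0 by (simp add: measure_pmf_in_subprob_algebra)
  next
    case (Suc m)
    have eq: "walk_kernel G n = (\<lambda>X. (\<lambda>x. measure_pmf (step_pmf G x)) (X m))"
      by (rule ext) (simp add: Suc)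
    show ?thesis unfolding eq
      by (rule measurable_compose[OF measurable_component_singleton])
        (auto simp: Suc space_subprob_algebra measure_pmf.subprob_space_axioms)
  qed
next
  fix n and X :: "nat \<Rightarrow> site"
  show "prob_space (walk_kernel G n X)"
    by (cases n) (auto intro: measure_pmf.prob_space_axioms)
qed

text \<open>
  The Ionescu-Tulcea measure of \<^const>\<open>walk_kernel\<close> on path space, i.e. the law of the Markov
  chain started at the origin with transition kernel \<^const>\<open>step_pmf\<close>; see
  \<open>emeasure_quenched_law_cylinder\<close> for its finite-dimensional distributions.
\<close>

definition quenched_law :: "environment \<Rightarrow> (nat \<Rightarrow> site) measure" where
  "quenched_law G =
     projective_family.lim UNIV
       (Ionescu_Tulcea.CI (walk_kernel G) (\<lambda>_. count_space UNIV)) (\<lambda>_. count_space UNIV)"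

lemma
  shows sets_quenched_law:
      "sets (quenched_law G) = sets (PiM UNIV (\<lambda>_. count_space UNIV))"
    and prob_space_quenched_law: "prob_space (quenched_law G)"
    and emeasure_quenched_law_cylinder:
      "emeasure (quenched_law G) {X. \<forall>i\<le>n. X i = x i} =
        ennreal (of_bool (x 0 = 0) * (\<Prod>i<n. pmf (step_pmf G (x i)) (x (Suc i))))"
proof -
  interpret IT: Ionescu_Tulcea "walk_kernel G" "\<lambda>_. count_space UNIV"
    by (rule Ionescu_Tulcea_walk_kernel)
  let ?M = "\<lambda>k :: nat. PiM {0..<k} (\<lambda>_. count_space (UNIV :: site set))"
  let ?C = "\<lambda>k. IT.C 0 k (\<lambda>_. undefined)"
  show sets_q: "sets (quenched_law G) = sets (PiM UNIV (\<lambda>_. count_space UNIV))"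
    by (simp add: quenched_law_def)
  have sing[measurable]: "{restrict x {0..<k}} \<in> sets (?M k)" for k :: nat and x
  proof -
    have "{restrict x {0..<k}} = PiE {0..<k} (\<lambda>i. {restrict x {0..<k} i})"
      by (subst PiE_singleton) auto
    also have "\<dots> \<in> sets (?M k)" by (rule sets_PiM_I_finite) auto
    finally show ?thesis .
  qed
  have undef: "(\<lambda>_. undefined) \<in> space (?M 0)" by (simp add: space_PiM)
  have step: "emeasure (?C (Suc k)) {restrict x {0..<Suc k}} =
      emeasure (walk_kernel G k (restrict x {0..<k})) {x k} * emeasure (?C k) {restrict x {0..<k}}" for k
  proof -
    have "emeasure (?C (Suc k)) {restrict x {0..<Suc k}} =
        (\<integral>\<^sup>+y. emeasure (IT.eP k y) {restrict x {0..<Suc k}} \<partial>?C k)"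
      using IT.space_C[OF undef, of k] IT.measurable_eP[of k] IT.sets_C[OF undef, of k] undef
      by (simp, subst emeasure_bind[where N = "?M (Suc k)"])
        (auto simp: space_PiM sing measurable_cong_sets[OF IT.sets_C[OF undef, of k] refl]
          simp del: restrict_apply cong: measurable_cong_sets)
    also have "\<dots> = (\<integral>\<^sup>+y. emeasure (walk_kernel G k (restrict x {0..<k})) {x k} *
        indicator {restrict x {0..<k}} y \<partial>?C k)"
    proof (rule nn_integral_cong)
      fix y assume "y \<in> space (?C k)"
      then have y: "y \<in> space (?M k)" using IT.space_C[OF undef, of k] by simp
      have "(\<lambda>z. y(k := z)) -` {restrict x {0..<Suc k}} =
          (if y = restrict x {0..<k} then {x k} else {})"
      proof -
        have "y(k := z) = restrict x {0..<Suc k} \<longleftrightarrow> y = restrict x {0..<k} \<and> z = x k" for z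
        proof
          assume eq: "y(k := z) = restrict x {0..<Suc k}"
          have "y i = restrict x {0..<k} i" for i
            using fun_cong[OF eq, of i] y
            by (cases "i = k") (auto simp: space_PiM PiE_def extensional_def restrict_def
                split: if_splits)
          moreover have "z = x k" using fun_cong[OF eq, of k] by simp
          ultimately show "y = restrict x {0..<k} \<and> z = x k" by auto
        qed (auto simp: fun_eq_iff)
        then show ?thesis by (auto simp del: fun_upd_apply restrict_apply restrict_upd)
      qed
      then show "emeasure (IT.eP k y) {restrict x {0..<Suc k}} =
          emeasure (walk_kernel G k (restrict x {0..<k})) {x k} * indicator {restrict x {0..<k}} y"
        by (subst IT.emeasure_eP[OF y sing]) (auto split: split_indicator)
    qed
    also have "\<dots> = emeasure (walk_kernel G k (restrict x {0..<k})) {x k} *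
        emeasure (?C k) {restrict x {0..<k}}"
      by (rule nn_integral_cmult_indicator) (simp add: IT.sets_C[OF undef])
    finally show ?thesis .
  qed
  have emeasure_C: "emeasure (?C (Suc n)) {restrict x {0..<Suc n}} =
      ennreal (of_bool (x 0 = 0) * (\<Prod>i<n. pmf (step_pmf G (x i)) (x (Suc i))))" for n
  proof (induction n)
    case 0
    have "emeasure (?C 0) {restrict x {0..<0}} = 1"
      using undef sing[of x 0] by (simp add: restrict_def)
    then show ?case
      by (subst step) (simp add: emeasure_pmf_single del: IT.C.simps)
  next
    case (Suc n)
    show ?case
      by (subst step, subst Suc)
        (simp add: emeasure_pmf_single ennreal_mult'[symmetric] prod_nonneg ac_simps
          del: IT.C.simps)
  qed
  have lim: "emeasure (quenched_law G) {X. \<forall>i<k. X i = x i} =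
      emeasure (?C k) {restrict x {0..<k}}" for k
  proof -
    have emb: "{X. \<forall>i<k. X i = x i} = IT.PF.emb UNIV {0..<k} {restrict x {0..<k}}"
      by (auto simp: prod_emb_def fun_eq_iff restrict_def) (metis (full_types))
    have "emeasure (quenched_law G) {X. \<forall>i<k. X i = x i} =
        emeasure (IT.CI {0..<k}) {restrict x {0..<k}}"
      unfolding quenched_law_def emb by (rule IT.lim) (auto intro: sing)
    also have "\<dots> = emeasure (?C k) (IT.PF.emb {0..<k} {0..<k} {restrict x {0..<k}})"
      by (rule IT.emeasure_CI) (auto intro: sing)
    also have "IT.PF.emb {0..<k} {0..<k} {restrict x {0..<k}} = {restrict x {0..<k}}"
      by (rule prod_emb_id) auto
    finally show ?thesis .
  qed
  show "emeasure (quenched_law G) {X. \<forall>i\<le>n. X i = x i} =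
      ennreal (of_bool (x 0 = 0) * (\<Prod>i<n. pmf (step_pmf G (x i)) (x (Suc i))))"
    using lim[of "Suc n"] unfolding emeasure_C less_Suc_eq_le .
  have sp: "space (quenched_law G) = UNIV"
    using sets_eq_imp_space_eq[OF sets_q] by (simp add: space_PiM)
  show "prob_space (quenched_law G)"
    using lim[of 0] undef sing[of x 0] by (intro prob_spaceI) (simp add: sp restrict_def)
qed

lemma measurable_quenched_law:
  "quenched_law \<in> measurable (PiM UNIV (\<lambda>_. count_space UNIV))
     (prob_algebra (PiM UNIV (\<lambda>_. count_space UNIV)))"
proof -
  let ?cyl = "\<lambda>(n::nat, x :: nat \<Rightarrow> site). {X. \<forall>i\<le>n. X i = x i}"
  let ?S = "PiM UNIV (\<lambda>_ :: nat. count_space (UNIV :: site set))"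
  let ?gen = "insert {} (range ?cyl)"
  have sp: "space ?S = UNIV" by (simp add: space_PiM)
  have cyl_sets: "?cyl (n, x) \<in> sets ?S" for n x
  proof -
    have "{X \<in> space ?S. \<forall>i\<in>{..n}. X i = x i} \<in> sets ?S" by measurable
    then show ?thesis by (simp add: sp Ball_def)
  qed
  have sub: "sets ?S \<subseteq> sigma_sets UNIV ?gen"
  proof -
    have gen_single: "{X. X i = s} \<in> sigma_sets UNIV ?gen" for i :: nat and s :: site
    proof -
      have eq: "{X. X i = s} = (\<Union>xs\<in>{xs :: site list. length xs = Suc i \<and> xs ! i = s}. ?cyl (i, \<lambda>j. xs ! j))"
      proof (intro set_eqI iffI)
        fix X assume "X \<in> {X :: nat \<Rightarrow> site. X i = s}"
        then show "X \<in> (\<Union>xs\<in>{xs :: site list. length xs = Suc i \<and> xs ! i = s}. ?cyl (i, \<lambda>j. xs ! j))"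
          by (intro UN_I[of "map X [0..<Suc i]"]) (auto simp del: upt_Suc)
      qed auto
      have "?cyl (i, \<lambda>j. xs ! j) \<in> sigma_sets UNIV ?gen" for xs :: "site list"
        by (rule sigma_sets.Basic) blast
      then show ?thesis unfolding eq
        by (intro sigma_sets_UNION) auto
    qed
    have gen: "{X. X i \<in> A} \<in> sigma_sets UNIV ?gen" for i :: nat and A :: "site set"
    proof -
      have "{X. X i \<in> A} = (\<Union>s\<in>A. {X. X i = s})" by auto
      then show ?thesis using gen_single
        by (simp only:) (intro sigma_sets_UNION, auto)
    qed
    have "sets ?S \<subseteq> sets (sigma UNIV ?gen)"
      by (rule sets_PiM_in_sets) (auto simp: gen)
    then show ?thesis by simp
  qed
  show ?thesis
  proof (rule measurable_prob_algebra_generated)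
    show "sets ?S = sigma_sets UNIV ?gen"
    proof (rule antisym[OF sub])
      show "sigma_sets UNIV ?gen \<subseteq> sets ?S"
      proof -
        have "?gen \<subseteq> sets ?S" using cyl_sets by auto
        from sets.sigma_sets_subset[OF this] show ?thesis by (simp only: sp)
      qed
    qed
    have cap: "?cyl (n, x) \<inter> ?cyl (m, y) \<in> ?gen" if "n \<le> m" for n m x y
    proof (cases "\<forall>i\<le>n. x i = y i")
      case True
      then have "?cyl (n, x) \<inter> ?cyl (m, y) = ?cyl (m, y)" using that by auto
      then show ?thesis by blast
    next
      case False
      then have "?cyl (n, x) \<inter> ?cyl (m, y) = {}" using that
        by (auto simp del: not_all)
      then show ?thesis by blast
    qed
    show "Int_stable ?gen"
    proof (rule Int_stableI)
      fix A B assume "A \<in> ?gen" "B \<in> ?gen"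
      then consider "A \<inter> B = {}" | n x m y where "A = ?cyl (n, x)" "B = ?cyl (m, y)"
        by auto
      then show "A \<inter> B \<in> ?gen"
      proof cases
        case 1 then show ?thesis by simp
      next
        case (2 n x m y)
        then show ?thesis using cap[of n m x y] cap[of m n y x] linear[of n m]
          by (simp only: Int_commute) blast
      qed
    qed
    show "?gen \<subseteq> Pow UNIV" by simp
    show "prob_space (quenched_law G)" for G by (rule prob_space_quenched_law)
    show "sets (quenched_law G) = sets ?S" for G by (rule sets_quenched_law)
    fix A assume "A \<in> ?gen"
    then consider "A = {}" | n x where "A = ?cyl (n, x)" by auto
    then show "(\<lambda>G. emeasure (quenched_law G) A) \<in>
        borel_measurable (PiM UNIV (\<lambda>_. count_space UNIV))"
    proof cases
      case (2 n x)
      have "(\<lambda>G. pmf (step_pmf G a) b) \<in> borel_measurable (PiM UNIV (\<lambda>_. count_space UNIV))" for a b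
        unfolding step_pmf_def
        by (rule measurable_compose[OF measurable_component_singleton[of a]]) auto
      then show ?thesis unfolding 2 prod.case emeasure_quenched_law_cylinder by measurable
    qed simp
  qed
qed

text \<open>
  The sets \<open>G x\<close> are i.i.d. with law \<open>\<mu>\<close>. \<open>\<bind>\<close> is only meaningful for a measurable kernel,
  which \<open>measurable_quenched_law\<close> provides.
\<close>

definition annealed_law :: "site set pmf \<Rightarrow> (nat \<Rightarrow> site) measure" where
  "annealed_law \<mu> = PiM UNIV (\<lambda>_ :: site. measure_pmf \<mu>) \<bind> quenched_law"

lemma
  shows sets_annealed_law: "sets (annealed_law \<mu>) = sets (PiM UNIV (\<lambda>_. count_space UNIV))"
    and prob_space_annealed_law: "prob_space (annealed_law \<mu>)"
proof -
  interpret product_prob_space "\<lambda>_ :: site. measure_pmf \<mu>" UNIV ..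
  have sets: "sets (PiM UNIV (\<lambda>_ :: site. measure_pmf \<mu>)) = sets (PiM UNIV (\<lambda>_. count_space UNIV))"
    by (rule sets_PiM_cong) auto
  have P: "PiM UNIV (\<lambda>_ :: site. measure_pmf \<mu>) \<in> space (prob_algebra (PiM UNIV (\<lambda>_. count_space UNIV)))"
    using P.prob_space_axioms sets by (simp add: space_prob_algebra)
  show "sets (annealed_law \<mu>) = sets (PiM UNIV (\<lambda>_. count_space UNIV))"
    unfolding annealed_law_def by (rule sets_bind'[OF P measurable_quenched_law])
  show "prob_space (annealed_law \<mu>)"
    unfolding annealed_law_def by (rule prob_space_bind'[OF P measurable_quenched_law])
qed

definition real_site :: "site \<Rightarrow> real \<times> real" where
  "real_site x = (of_int (fst x), of_int (snd x))"

definition three_or_down_pmf :: "real \<Rightarrow> site set pmf" where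
  "three_or_down_pmf p =
     map_pmf (\<lambda>b. if b then {e1, - e1, - e2} else {- e2}) (bernoulli_pmf p)"

end

(*
  The walk never returns to a row that it has left, so it sees a fresh row of the environment after
  each down step. Hence its trajectory is a concatenation of i.i.d. words, each a sequence of
  horizontal steps followed by one down step, and v = (0, -1/T) by a law of large numbers, where T
  is the mean word length; the horizontal mean vanishes by reflection. Words have exponential tails
  (a site of the first kind is left downwards with probability 1/3), so Chernoff bounds and
  Borel-Cantelli suffice.

  In a fixed row the mean exit time h satisfies h(x) = 1 + (h(x+1) + h(x-1)) / 3 on three-way
  sites and h = 1 on the others. Since phi = (3 + sqrt 5) / 2 solves t + 1/t = 3, one has
  h = 3 - 2 (phi^j + phi^(L-j)) / (1 + phi^L) between two down sites at distance L, at distance j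
  from the left one. Summing over (L, j), which has probability p^(L-1) (1-p)^2, gives T.
*)
theory Submission
  imports Defs
begin

subsection \<open>Exit from a fixed row\<close>

text \<open>Row words are never introduced as random variables on path space. Comparing these
  products with k independent samples from one pmf on finite words transfers every estimate to the
  walk. Two facts carry this comparison: the word weights sum to 1 (no row traps the walk), and a
  path determines its words.

  Origin of the formula: 3 is the constant solution of h = 1 + 2h/3, and the powers of phi correct
  it to the boundary value 1. The value 1 on a down site and the constant 3 elsewhere average to (1
  - p) + 3p = 1 + 2p. The correction, summed over j, is a geometric sum of the shape A - B / (1 +
  phi^L). Its A part gives the term with 8p(1 - p), its B part the infinite series, and 1/v[2] =
  -T.\<close>

definition sign :: "bool \<Rightarrow> int" where "sign b = (if b then 1 else - 1)"

text \<open>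
  In a row whose three-way sites are marked by \<open>a\<close>, the probability that the walk started at \<open>x\<close>
  makes the horizontal steps \<open>s\<close> and then goes down.
\<close>

fun row_weight :: "(int \<Rightarrow> bool) \<Rightarrow> int \<Rightarrow> bool list \<Rightarrow> real" where
  "row_weight a x [] = (if a x then 1 / 3 else 1)"
| "row_weight a x (b # s) = (if a x then row_weight a (x + sign b) s / 3 else 0)"

lemma row_weight_nonneg: "0 \<le> row_weight a x s"
  by (induction s arbitrary: x) auto

lemma row_weight_le_1: "row_weight a x s \<le> 1"
proof (induction s arbitrary: x)
  case (Cons b s)
  show ?case using Cons[of "x + sign b"] by auto
qed auto

text \<open>Mirroring the row and exchanging left with right steps cancel out. This symmetry is the
  source of the vanishing horizontal speed.\<close>

lemma row_weight_reflect:
  "row_weight (\<lambda>i. a (- i)) (- x) s = row_weight a x (map Not s)"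
proof (induction s arbitrary: x)
  case (Cons b s)
  have "- x + sign b = - (x + sign (\<not> b))" by (simp add: sign_def)
  then show ?case using Cons[of "x + sign (\<not> b)"] by simp
qed simp

text \<open>Obtained by first-step analysis. The index counts horizontal steps only, so the
  corresponding exit happens at time \<open>Suc n\<close>.\<close>

fun exit_prob :: "(int \<Rightarrow> bool) \<Rightarrow> nat \<Rightarrow> int \<Rightarrow> real" where
  "exit_prob a 0 x = (if a x then 1 / 3 else 1)"
| "exit_prob a (Suc n) x = (if a x then (exit_prob a n (x + 1) + exit_prob a n (x - 1)) / 3 else 0)"

lemma bool_lists_Suc:
  "{s :: bool list. length s = Suc n} =
     (#) True ` {s. length s = n} \<union> (#) False ` {s. length s = n}"
  by (auto simp: length_Suc_conv image_iff)

lemma finite_bool_lists: "finite {s :: bool list. length s = n}"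
  using finite_lists_length_eq[of "UNIV :: bool set" n] by simp

lemma sum_row_weight: "(\<Sum>s | length s = n. row_weight a x s) = exit_prob a n x"
proof (induction n arbitrary: x)
  case (Suc n)
  have "(\<Sum>s | length s = Suc n. row_weight a x s) =
    (\<Sum>s | length s = n. row_weight a x (True # s)) + (\<Sum>s | length s = n. row_weight a x (False # s))"
    unfolding bool_lists_Suc
    by (subst sum.union_disjoint) (auto simp: finite_bool_lists sum.reindex inj_on_def)
  also have "\<dots> = exit_prob a (Suc n) x"
    using Suc[of "x + 1"] Suc[of "x - 1"] by (simp add: sign_def sum_divide_distrib[symmetric] add_divide_distrib)
  finally show ?case .
qed simp

lemma exit_prob_nonneg: "0 \<le> exit_prob a n x"
  by (induction n arbitrary: x) auto

lemma exit_prob_le: "exit_prob a n x \<le> (2 / 3) ^ n"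
proof (induction n arbitrary: x)
  case (Suc n)
  show ?case using Suc[of "x + 1"] Suc[of "x - 1"] by (auto simp: field_simps)
qed auto

text \<open>The difference is the probability of making at least \<open>n\<close> horizontal steps.
  It obeys the same first-step recursion as \<open>exit_prob\<close>, and each three-way site passes
  on at most 2/3 of it.\<close>

lemma survival_bound:
  "0 \<le> 1 - (\<Sum>i<n. exit_prob a i x) \<and> 1 - (\<Sum>i<n. exit_prob a i x) \<le> (2 / 3) ^ n"
proof (induction n arbitrary: x)
  case (Suc n)
  show ?case
  proof (cases "a x")
    case True
    have "(\<Sum>i<Suc n. exit_prob a i x) =
        1 / 3 + ((\<Sum>i<n. exit_prob a i (x + 1)) + (\<Sum>i<n. exit_prob a i (x - 1))) / 3"
      unfolding sum.lessThan_Suc_shift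
      using True by (simp add: sum.distrib sum_divide_distrib[symmetric])
    then have "1 - (\<Sum>i<Suc n. exit_prob a i x) =
        ((1 - (\<Sum>i<n. exit_prob a i (x + 1))) + (1 - (\<Sum>i<n. exit_prob a i (x - 1)))) / 3"
      by (simp add: field_simps)
    then show ?thesis using Suc[of "x + 1"] Suc[of "x - 1"] by (simp del: sum.lessThan_Suc)
  qed (simp del: sum.lessThan_Suc add: sum.lessThan_Suc_shift)
qed simp

lemma exit_prob_sums: "(\<lambda>n. exit_prob a n x) sums 1"
proof -
  have "(\<lambda>n. 1 - (\<Sum>i<n. exit_prob a i x)) \<longlonglongrightarrow> 0"
    by (rule tendsto_sandwich[OF _ _ tendsto_const LIMSEQ_realpow_zero[of "2 / 3 :: real"]])
      (use survival_bound[of a x] in auto)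
  from tendsto_diff[OF tendsto_const[of 1] this] show ?thesis by (simp add: sums_def)
qed

section \<open>Mean exit time from a fixed row\<close>

definition mean_exit :: "(int \<Rightarrow> bool) \<Rightarrow> int \<Rightarrow> real" where
  "mean_exit a x = (\<Sum>n. real (Suc n) * exit_prob a n x)"

lemma sums_Suc_geometric:
  fixes c :: real assumes "norm c < 1"
  shows "(\<lambda>n. real (Suc n) * c ^ n) sums (1 / (1 - c)\<^sup>2)"
  using geometric_deriv_sums[OF assms] by simp

lemma summable_mean_exit: "summable (\<lambda>n. real (Suc n) * exit_prob a n x)"
  by (rule summable_comparison_test[OF _ sums_summable[OF sums_Suc_geometric[of "2 / 3"]]])
    (auto simp: exit_prob_nonneg exit_prob_le intro!: mult_left_mono)

lemma mean_exit_bounds: "0 \<le> mean_exit a x" "mean_exit a x \<le> 9"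
proof -
  show "0 \<le> mean_exit a x" unfolding mean_exit_def
    by (rule suminf_nonneg[OF summable_mean_exit]) (simp add: exit_prob_nonneg)
  have "mean_exit a x \<le> (\<Sum>n. real (Suc n) * (2 / 3) ^ n)" unfolding mean_exit_def
    by (rule suminf_le[OF _ summable_mean_exit sums_summable[OF sums_Suc_geometric]])
      (auto simp: exit_prob_le intro!: mult_left_mono)
  also have "\<dots> = 9" using sums_unique[OF sums_Suc_geometric[of "2 / 3"]] by (simp add: power2_eq_square)
  finally show "mean_exit a x \<le> 9" .
qed

lemma mean_exit_eq:
  "mean_exit a x = 1 + (if a x then (mean_exit a (x + 1) + mean_exit a (x - 1)) / 3 else 0)"
proof (cases "a x")
  case False
  have "(\<lambda>n. real (Suc n) * exit_prob a n x) = (\<lambda>n. if n = 0 then 1 else 0)"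
  proof
    fix n show "real (Suc n) * exit_prob a n x = (if n = 0 then 1 else 0)"
      using False by (cases n) auto
  qed
  moreover have "(\<lambda>n :: nat. if n = 0 then 1 else 0 :: real) sums 1" by (rule sums_single)
  ultimately show ?thesis using False by (simp add: mean_exit_def sums_unique[symmetric])
next
  case True
  let ?e = "\<lambda>y n. exit_prob a n y"
  have s: "(\<lambda>n. real (Suc n) * ?e y n) sums mean_exit a y" for y
    unfolding mean_exit_def by (rule summable_sums[OF summable_mean_exit])
  \<comment> \<open>The step to a neighbour costs one unit of time: adding \<open>exit_prob\<close>
    once more raises the weight \<open>Suc n\<close> to \<open>Suc (Suc n)\<close>, and these extra
    terms sum to 1.\<close>
  have "(\<lambda>n. ((real (Suc n) * ?e (x + 1) n + ?e (x + 1) n) + (real (Suc n) * ?e (x - 1) n + ?e (x - 1) n)) / 3)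
      sums (((mean_exit a (x + 1) + 1) + (mean_exit a (x - 1) + 1)) / 3)"
    by (intro sums_divide sums_add s exit_prob_sums)
  moreover have "(real (Suc n) * ?e (x + 1) n + ?e (x + 1) n + (real (Suc n) * ?e (x - 1) n + ?e (x - 1) n)) / 3
      = real (Suc (Suc n)) * ?e x (Suc n)" for n
    using True by (simp add: field_simps)
  ultimately have "(\<lambda>n. real (Suc (Suc n)) * ?e x (Suc n)) sums
      (((mean_exit a (x + 1) + 1) + (mean_exit a (x - 1) + 1)) / 3)" by simp
  \<comment> \<open>This restores the term for \<open>n = 0\<close>, the immediate exit with
    probability 1/3; the constants then add up to 1/3 + 1/3 + 1/3 = 1.\<close>
  from sums_Suc[where f = "\<lambda>n. real (Suc n) * ?e x n", OF this]
  have "(\<lambda>n. real (Suc n) * ?e x n) sums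
      (((mean_exit a (x + 1) + 1) + (mean_exit a (x - 1) + 1)) / 3 + 1 / 3)"
    using True by simp
  from sums_unique2[OF s this] True show ?thesis by (simp add: field_simps)
qed

text \<open>The recursion for the mean is a contraction with factor \<open>2/3\<close> in the supremum norm.\<close>

lemma mean_exit_unique:
  assumes bdd: "\<And>x. \<bar>K x\<bar> \<le> B"
    and K: "\<And>x. K x = 1 + (if a x then (K (x + 1) + K (x - 1)) / 3 else 0)"
  shows "mean_exit a x = K x"
proof -
  have "\<bar>mean_exit a x - K x\<bar> \<le> (2 / 3) ^ n * (9 + B)" for n x
  proof (induction n arbitrary: x)
    case 0
    show ?case using mean_exit_bounds[of a x] bdd[of x] by simp
  next
    case (Suc n)
    define c where "c = (2 / 3) ^ n * (9 + B)"
    have *: "\<bar>mean_exit a y - K y\<bar> \<le> c" for y using Suc by (simp add: c_def)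
    from order_trans[OF abs_ge_zero *] have "0 \<le> c" .
    then have "\<bar>mean_exit a x - K x\<bar> \<le> 2 / 3 * c"
      using *[of "x + 1"] *[of "x - 1"]
      by (subst mean_exit_eq, subst K) (auto simp: field_simps abs_le_iff)
    then show ?case by (simp add: c_def)
  qed
  moreover have "(\<lambda>n. (2 / 3) ^ n * (9 + B)) \<longlonglongrightarrow> 0"
    by (rule tendsto_mult_left_zero[OF LIMSEQ_realpow_zero]) auto
  ultimately have "\<bar>mean_exit a x - K x\<bar> \<le> 0"
    by (intro tendsto_lowerbound[of _ 0 sequentially]) auto
  then show ?thesis by simp
qed

section \<open>Explicit solution between two down sites\<close>

definition phi :: real where "phi = (3 + sqrt 5) / 2"

lemma phi_gt_1: "1 < phi" by (simp add: phi_def) (smt (verit) real_sqrt_gt_zero)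

lemma phi_sq: "phi\<^sup>2 = 3 * phi - 1"
  by (simp add: phi_def power2_eq_square field_simps)

lemma phi_rec: "phi ^ (Suc (Suc n)) + phi ^ n = 3 * phi ^ (Suc n)"
proof -
  have "phi ^ (Suc (Suc n)) + phi ^ n = (phi\<^sup>2 + 1) * phi ^ n" by (simp add: power2_eq_square algebra_simps)
  then show ?thesis by (simp add: phi_sq)
qed

text \<open>Uniqueness is a statement about the whole line, whereas the formula makes sense only on
  the run. The candidate \<open>K\<close> is therefore glued: the formula on the run and
  \<open>mean_exit\<close> itself elsewhere. The two pieces agree at the ends, where both equal 1,
  so the recursion survives across the seam.\<close>

lemma mean_exit_run:
  assumes j: "0 < j" "j < L"
    and run: "\<And>i. - int j < i \<Longrightarrow> i < int L - int j \<Longrightarrow> a i"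
    and ends: "\<not> a (- int j)" "\<not> a (int L - int j)"
  shows "mean_exit a 0 = 3 - 2 * (phi ^ j + phi ^ (L - j)) / (1 + phi ^ L)"
proof -
  define in_run where "in_run x \<longleftrightarrow> - int j \<le> x \<and> x \<le> int L - int j" for x
  define k where "k x = 3 - 2 * (phi ^ nat (x + int j) + phi ^ nat (int L - int j - x)) / (1 + phi ^ L)" for x
  define K where "K x = (if in_run x then k x else mean_exit a x)" for x
  have denom_pos: "1 + phi ^ L > 0" using phi_gt_1 by (simp add: add_pos_pos)
  have kend: "k (- int j) = 1" "k (int L - int j) = 1"
    using denom_pos by (simp_all add: k_def field_simps)
  have Hend: "mean_exit a (- int j) = 1" "mean_exit a (int L - int j) = 1"
    using ends by (auto simp: mean_exit_eq[of a "- int j"] mean_exit_eq[of a "int L - int j"])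
  have K_out: "K x = mean_exit a x" if out: "\<not> (- int j < x \<and> x < int L - int j)" for x
  proof -
    consider "x = - int j" | "x = int L - int j" | "\<not> in_run x" using out by (force simp: in_run_def)
    then show ?thesis by cases (use j kend Hend in \<open>auto simp: K_def in_run_def\<close>)
  qed
  have "mean_exit a 0 = K 0"
  proof (rule mean_exit_unique)
    fix x
    show "\<bar>K x\<bar> \<le> 9 + (3 + 4 * phi ^ L)"
    proof (cases "in_run x")
      case True
      have "phi ^ nat (x + int j) \<le> phi ^ L" "phi ^ nat (int L - int j - x) \<le> phi ^ L"
        using True phi_gt_1 by (auto simp: in_run_def intro!: power_increasing)
      moreover have "0 \<le> phi ^ nat (x + int j)" "0 \<le> phi ^ nat (int L - int j - x)"
        using phi_gt_1 by auto
      moreover define num where "num = 2 * (phi ^ nat (x + int j) + phi ^ nat (int L - int j - x))"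
      ultimately have "0 \<le> num" "num \<le> 4 * phi ^ L" by auto
      moreover have "num / (1 + phi ^ L) \<le> num / 1"
        using \<open>0 \<le> num\<close> denom_pos phi_gt_1 by (intro divide_left_mono) auto
      moreover have "0 \<le> num / (1 + phi ^ L)" using \<open>0 \<le> num\<close> denom_pos by simp
      moreover have "K x = 3 - num / (1 + phi ^ L)" using True by (simp add: K_def k_def num_def)
      ultimately show ?thesis by auto
    next
      case False
      have "0 \<le> phi ^ L" using phi_gt_1 by simp
      then show ?thesis using False mean_exit_bounds[of a x] by (simp add: K_def)
    qed
    show "K x = 1 + (if a x then (K (x + 1) + K (x - 1)) / 3 else 0)"
    proof (cases "- int j < x \<and> x < int L - int j")
      case True
      \<comment> \<open>Strictly inside the run both exponents are positive, so the truncated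
        subtraction is exact and \<open>phi_rec\<close> applies to the exponents u, u + 1, u + 2 and
        v, v + 1, v + 2.\<close>
      define u v where "u = nat (x + int j) - 1" and "v = nat (int L - int j - x) - 1"
      have uv: "nat (x + int j) = Suc u" "nat (int L - int j - x) = Suc v"
        "nat (x + 1 + int j) = Suc (Suc u)" "nat (x - 1 + int j) = u"
        "nat (int L - int j - (x + 1)) = v" "nat (int L - int j - (x - 1)) = Suc (Suc v)"
        using True by (auto simp: u_def v_def)
      have "K x = k x" "K (x + 1) = k (x + 1)" "K (x - 1) = k (x - 1)"
        using True by (auto simp: K_def in_run_def)
      moreover have "k (x + 1) + k (x - 1) = 3 * (k x - 1)"
      proof -
        have "k (x + 1) + k (x - 1) = 6 - 2 * ((phi ^ Suc (Suc u) + phi ^ u) + (phi ^ Suc (Suc v) + phi ^ v)) / (1 + phi ^ L)"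
          unfolding k_def uv by (simp add: add_divide_distrib algebra_simps)
        also have "\<dots> = 3 * (k x - 1)"
          unfolding phi_rec k_def uv by (simp add: algebra_simps add_divide_distrib)
        finally show ?thesis .
      qed
      ultimately show ?thesis using run True by (simp add: diff_divide_distrib)
    next
      case False
      \<comment> \<open>A three-way site off the interior is not an end of the run, so it lies
        strictly outside; its neighbours can reach an end but not the interior.\<close>
      have "K (x + 1) = mean_exit a (x + 1) \<and> K (x - 1) = mean_exit a (x - 1)" if "a x"
        using False that ends by (intro conjI K_out) (smt (verit))+
      then show ?thesis using K_out[OF False] mean_exit_eq[of a x] by auto
    qed
  qed
  also have "\<dots> = 3 - 2 * (phi ^ j + phi ^ (L - j)) / (1 + phi ^ L)"
    using j by (simp add: K_def in_run_def k_def nat_diff_distrib)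
  finally show ?thesis .
qed

subsection \<open>Factorization of the annealed law over rows\<close>

definition three :: "site set" where "three = {e1, - e1, - e2}"

definition down :: "site set" where "down = {- e2}"

definition env_law :: "real \<Rightarrow> environment measure" where
  "env_law p = PiM UNIV (\<lambda>_. measure_pmf (three_or_down_pmf p))"

definition env_row :: "environment \<Rightarrow> int \<Rightarrow> int \<Rightarrow> bool" where
  "env_row G y i \<longleftrightarrow> G (i, y) = three"

text \<open>The direction \<open>e2\<close> never occurs, so \<open>None\<close> for down and
  \<open>Some b\<close> for the two horizontal steps exhaust the possible moves. This makes path
  codes and trajectories equivalent.\<close>

fun step_vec :: "bool option \<Rightarrow> site" where
  "step_vec None = - e2"
| "step_vec (Some b) = (sign b, 0)"

definition endpoint :: "bool option list \<Rightarrow> site" where "endpoint \<sigma> = sum_list (map step_vec \<sigma>)"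

fun quenched_weight :: "environment \<Rightarrow> site \<Rightarrow> bool option list \<Rightarrow> real" where
  "quenched_weight G x [] = 1"
| "quenched_weight G x (c # \<sigma>) = pmf (pmf_of_set (G x)) (step_vec c) * quenched_weight G (x + step_vec c) \<sigma>"

definition cylinder :: "bool option list \<Rightarrow> (nat \<Rightarrow> site) set" where
  "cylinder \<sigma> = {X. \<forall>i\<le>length \<sigma>. X i = endpoint (take i \<sigma>)}"

definition encode :: "bool list list \<Rightarrow> bool option list" where
  "encode l = concat (map (\<lambda>s. map Some s @ [None]) l)"

definition disp :: "bool list \<Rightarrow> int" where "disp s = sum_list (map sign s)"

lemma endpoint_simps [simp]: "endpoint [] = 0" "endpoint (c # \<sigma>) = step_vec c + endpoint \<sigma>"
  by (simp_all add: endpoint_def)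

lemma endpoint_append: "endpoint (\<sigma> @ \<tau>) = endpoint \<sigma> + endpoint \<tau>"
  by (simp add: endpoint_def)

lemma disp_simps [simp]: "disp [] = 0" "disp (b # s) = sign b + disp s"
  by (simp_all add: disp_def)

lemma encode_simps [simp]: "encode [] = []" "encode (s # l) = map Some s @ None # encode l"
  by (simp_all add: encode_def)

lemma pmf_step_pmf: "pmf (step_pmf G x) (x + e) = pmf (pmf_of_set (G x)) e"
  unfolding step_pmf_def by (subst pmf_map_inj') (auto simp: inj_on_def)

lemma quenched_weight_prod:
  "quenched_weight G x \<sigma> =
     (\<Prod>i<length \<sigma>. pmf (step_pmf G (x + endpoint (take i \<sigma>))) (x + endpoint (take (Suc i) \<sigma>)))"
proof (induction \<sigma> arbitrary: x)
  case (Cons c \<sigma>)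
  show ?case
    unfolding quenched_weight.simps Cons length_Cons prod.lessThan_Suc_shift
    by (simp add: pmf_step_pmf add.assoc)
qed simp

lemma emeasure_quenched_law_path: "emeasure (quenched_law G) (cylinder \<sigma>) = ennreal (quenched_weight G 0 \<sigma>)"
  unfolding cylinder_def emeasure_quenched_law_cylinder[of G "length \<sigma>" "\<lambda>i. endpoint (take i \<sigma>)"]
  by (simp add: quenched_weight_prod[of G 0])

lemma quenched_weight_nonneg: "0 \<le> quenched_weight G x \<sigma>"
  by (induction \<sigma> arbitrary: x) auto

lemma quenched_weight_le_1: "quenched_weight G x \<sigma> \<le> 1"
proof (induction \<sigma> arbitrary: x)
  case (Cons c \<sigma>)
  then show ?case
    by (simp del: split_paired_All add: mult_le_one pmf_le_1 quenched_weight_nonneg)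
qed simp

text \<open>No coded step goes up, so a path only consults sites in its starting row or below.
  Independence of successive rows rests on this.\<close>

lemma quenched_weight_cong:
  assumes "\<And>z. snd z \<le> snd x \<Longrightarrow> G z = G' z"
  shows "quenched_weight G x \<sigma> = quenched_weight G' x \<sigma>"
  using assms
proof (induction \<sigma> arbitrary: x)
  case (Cons c \<sigma>)
  have "snd (x + step_vec c) \<le> snd x" by (cases c) auto
  then have "quenched_weight G (x + step_vec c) \<sigma> = quenched_weight G' (x + step_vec c) \<sigma>"
    by (intro Cons.IH Cons.prems) simp
  then show ?case using Cons.prems[of x] by simp
qed simp

lemma row_weight_cong:
  assumes "\<And>i. a i = a' i"
  shows "row_weight a x s = row_weight a' x s"
proof -
  have "a = a'" using assms by auto
  then show ?thesis by simp
qed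

lemma pmf_step_sets:
  "pmf (pmf_of_set three) (step_vec c) = 1 / 3"
  "pmf (pmf_of_set down) (step_vec c) = of_bool (c = None)"
  by (cases c; simp add: sign_def three_def down_def)+

lemma three_neq_down: "three \<noteq> down" "down \<noteq> three"
  by (auto simp: three_def down_def)

text \<open>All steps of the word, including the final one down, are decided by row
  \<open>y\<close>; what follows starts one row lower. The assumption on \<open>G\<close> holds
  almost surely by \<open>AE_env_law\<close>.\<close>

lemma quenched_weight_encode:
  assumes G: "\<And>z. G z = three \<or> G z = down"
  shows "quenched_weight G (x, y) (map Some s @ None # \<sigma>) =
    row_weight (env_row G y) x s * quenched_weight G (x + disp s, y - 1) \<sigma>"
proof (induction s arbitrary: x)
  case Nil
  have eq: "(x, y) + step_vec None = (x, y - 1)" by simp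
  have "quenched_weight G (x, y) (map Some [] @ None # \<sigma>) =
      pmf (pmf_of_set (G (x, y))) (step_vec None) * quenched_weight G (x, y - 1) \<sigma>"
    by (simp only: list.map append.simps quenched_weight.simps eq)
  moreover have "pmf (pmf_of_set (G (x, y))) (step_vec None) = row_weight (env_row G y) x []"
    using G[of "(x, y)"] three_neq_down
    by (elim disjE) (simp_all only: pmf_step_sets env_row_def row_weight.simps if_True if_False simp_thms of_bool_eq)
  ultimately show ?case by simp
next
  case (Cons b s)
  have eq: "(x, y) + step_vec (Some b) = (x + sign b, y)" by simp
  have "quenched_weight G (x, y) (map Some (b # s) @ None # \<sigma>) =
      pmf (pmf_of_set (G (x, y))) (step_vec (Some b)) *
        (row_weight (env_row G y) (x + sign b) s * quenched_weight G (x + sign b + disp s, y - 1) \<sigma>)"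
    by (simp only: list.map append.simps quenched_weight.simps eq Cons)
  moreover have "pmf (pmf_of_set (G (x, y))) (step_vec (Some b)) = (if env_row G y x then 1 / 3 else 0)"
    using G[of "(x, y)"] three_neq_down
    by (elim disjE) (simp_all only: pmf_step_sets env_row_def if_True if_False of_bool_eq option.distinct simp_thms)
  ultimately show ?case by (simp only: row_weight.simps disp_simps add.assoc) simp
qed

section \<open>The i.i.d. environment: invariance and independence\<close>

lemma prob_space_env_law: "prob_space (env_law p)"
  unfolding env_law_def by (intro prob_space_PiM measure_pmf.prob_space_axioms)

lemma space_env_law [simp]: "space (env_law p) = UNIV"
  by (simp add: env_law_def space_PiM)

lemma measurable_env_component [measurable]: "(\<lambda>G. G z) \<in> measurable (env_law p) (count_space UNIV)"
  unfolding env_law_def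
  by (rule measurable_compose[OF measurable_component_singleton[of z]]) simp_all

lemma measurable_env_row [measurable]: "Measurable.pred (env_law p) (\<lambda>G. env_row G y i)"
  unfolding env_row_def by measurable

lemma measurable_row_weight [measurable]:
  "(\<lambda>G. row_weight (env_row G y) x s) \<in> borel_measurable (env_law p)"
  by (induction s arbitrary: x) simp_all

lemma measurable_quenched_weight [measurable]:
  "(\<lambda>G. quenched_weight G x \<sigma>) \<in> borel_measurable (env_law p)"
proof (induction \<sigma> arbitrary: x)
  case (Cons c \<sigma>)
  have "(\<lambda>G. pmf (pmf_of_set (G x)) (step_vec c)) \<in> borel_measurable (env_law p)"
    by (rule measurable_compose[OF measurable_env_component]) simp
  with Cons show ?case by simp
qed simp

lemma AE_env_law: "AE G in env_law p. \<forall>z. G z = three \<or> G z = down"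
  unfolding AE_all_countable
proof
  fix z
  have "AE g in measure_pmf (three_or_down_pmf p). g = three \<or> g = down"
    by (auto simp: AE_measure_pmf_iff three_or_down_pmf_def three_def down_def)
  then show "AE G in env_law p. G z = three \<or> G z = down"
    unfolding env_law_def
    by (intro AE_PiM_component[where P = "\<lambda>g. g = three \<or> g = down"] measure_pmf.prob_space_axioms) auto
qed

text \<open>An i.i.d. family keeps its law under any injective relabelling of sites. Used for
  translations, which make all rows alike, and for the reflection of the first coordinate.\<close>

lemma integral_env_law_reindex:
  fixes f :: "environment \<Rightarrow> real"
  assumes [measurable]: "f \<in> borel_measurable (env_law p)" and "inj \<pi>"
  shows "(\<integral>G. f (\<lambda>z. G (\<pi> z)) \<partial>env_law p) = (\<integral>G. f G \<partial>env_law p)"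
proof -
  have "distr (env_law p) (env_law p) (\<lambda>G z. G (\<pi> z)) = env_law p"
    using distr_PiM_reindex[of UNIV "\<lambda>_. measure_pmf (three_or_down_pmf p)" \<pi> UNIV] \<open>inj \<pi>\<close>
    by (simp add: env_law_def measure_pmf.prob_space_axioms restrict_UNIV)
  moreover have [measurable]: "(\<lambda>G z. G (\<pi> z)) \<in> measurable (env_law p) (env_law p)"
    using measurable_env_component[of _ p] unfolding env_law_def
    by (intro measurable_PiM_single') (auto simp: space_PiM simp del: split_paired_All)
  ultimately show ?thesis by (metis assms(1) integral_distr)
qed

lemma measurable_If_restrict_component:
  "(\<lambda>\<omega>. if z \<in> I then \<omega> z else undefined) \<in> measurable (PiM I (\<lambda>_. measure_pmf \<mu>)) (count_space UNIV)"
proof (cases "z \<in> I")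
  case True
  then have "(\<lambda>\<omega>. \<omega> z) \<in> measurable (PiM I (\<lambda>_. measure_pmf \<mu>)) (measure_pmf \<mu>)"
    by (rule measurable_component_singleton)
  with True show ?thesis by simp
qed simp

text \<open>Padding with \<open>undefined\<close> off \<open>I\<close> lets a function of full
  environments act on partial ones, as required for comparing restrictions of the environment to
  disjoint sets of sites.\<close>

lemma measurable_env_law_restrict:
  fixes f :: "environment \<Rightarrow> real"
  assumes f: "f \<in> borel_measurable (env_law p)"
  shows "(\<lambda>\<omega>. f (\<lambda>z. if z \<in> I then \<omega> z else undefined)) \<in>
    borel_measurable (PiM I (\<lambda>_. measure_pmf (three_or_down_pmf p)))"
  by (rule measurable_compose[OF _ f], unfold env_law_def, intro measurable_PiM_single')
     (auto simp: space_PiM simp del: split_paired_All intro!: measurable_If_restrict_component)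

lemma integral_env_law_indep:
  fixes f g :: "environment \<Rightarrow> real"
  assumes f [measurable]: "f \<in> borel_measurable (env_law p)" and g [measurable]: "g \<in> borel_measurable (env_law p)"
    and bounds: "\<And>G. 0 \<le> f G" "\<And>G. f G \<le> 1" "\<And>G. 0 \<le> g G" "\<And>G. g G \<le> 1"
    and IJ: "I \<inter> J = {}"
    and dep: "\<And>G G'. (\<And>z. z \<in> I \<Longrightarrow> G z = G' z) \<Longrightarrow> f G = f G'"
      "\<And>G G'. (\<And>z. z \<in> J \<Longrightarrow> G z = G' z) \<Longrightarrow> g G = g G'"
  shows "(\<integral>G. f G * g G \<partial>env_law p) = (\<integral>G. f G \<partial>env_law p) * (\<integral>G. g G \<partial>env_law p)"
proof -
  let ?\<mu> = "\<lambda>_ :: site. measure_pmf (three_or_down_pmf p)"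
  interpret prob_space "env_law p" by (rule prob_space_env_law)
  have rv: "random_variable (?\<mu> z) (\<lambda>G. G z)" for z
    using measurable_env_component[of z p] by (simp cong: measurable_cong_sets)
  have "indep_vars ?\<mu> (\<lambda>z G. G z) UNIV"
  proof (subst indep_vars_iff_distr_eq_PiM[OF _ rv])
    have "distr (env_law p) (?\<mu> z) (\<lambda>G. G z) = ?\<mu> z" for z
      unfolding env_law_def by (rule distr_PiM_component) (auto intro: measure_pmf.prob_space_axioms)
    then show "distr (env_law p) (PiM UNIV ?\<mu>) (\<lambda>G. \<lambda>z\<in>UNIV. G z) = PiM UNIV (\<lambda>z. distr (env_law p) (?\<mu> z) (\<lambda>G. G z))"
      by (simp add: restrict_UNIV env_law_def distr_id)
  qed simp
  from indep_var_restrict[OF this IJ]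
  have "indep_var (PiM I ?\<mu>) (\<lambda>G. restrict G I) (PiM J ?\<mu>) (\<lambda>G. restrict G J)" by simp
  from indep_var_compose[OF this measurable_env_law_restrict[OF f, of I] measurable_env_law_restrict[OF g, of J]]
  have "indep_var borel (\<lambda>G. f (\<lambda>z. if z \<in> I then restrict G I z else undefined))
      borel (\<lambda>G. g (\<lambda>z. if z \<in> J then restrict G J z else undefined))"
    by (simp add: o_def)
  \<comment> \<open>Since \<open>f\<close> only looks at sites in \<open>I\<close>, the padding does
    not change its value.\<close>
  moreover have "(\<lambda>G. f (\<lambda>z. if z \<in> I then restrict G I z else undefined)) = f"
    by (rule ext, rule dep(1)) simp
  moreover have "(\<lambda>G. g (\<lambda>z. if z \<in> J then restrict G J z else undefined)) = g"
    by (rule ext, rule dep(2)) simp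
  ultimately have "indep_var borel f borel g" by simp
  then show ?thesis
    using bounds by (intro indep_var_lebesgue_integral integrable_const_bound[of _ 1]) auto
qed

definition word_weight :: "real \<Rightarrow> bool list \<Rightarrow> real" where
  "word_weight p s = (\<integral>G. row_weight (env_row G 0) 0 s \<partial>env_law p)"

lemma row_weight_shift: "row_weight (\<lambda>i. a (i + c)) x s = row_weight a (x + c) s"
proof (induction s arbitrary: x)
  case (Cons b s)
  have eq: "x + sign b + c = x + c + sign b" by simp
  show ?case by (simp add: Cons eq)
qed simp

lemma integral_row_weight: "(\<integral>G. row_weight (env_row G y) x s \<partial>env_law p) = word_weight p s"
proof -
  have "word_weight p s = (\<integral>G. row_weight (env_row (\<lambda>z. G (z + (x, y))) 0) 0 s \<partial>env_law p)"
    unfolding word_weight_def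
    by (rule integral_env_law_reindex[where \<pi> = "\<lambda>z. z + (x, y)", symmetric]) (auto simp: inj_on_def)
  moreover have "env_row (\<lambda>z. G (z + (x, y))) 0 = (\<lambda>i. env_row G y (i + x))" for G
    by (auto simp: env_row_def)
  ultimately show ?thesis by (simp add: row_weight_shift)
qed

lemma word_weight_reflect: "word_weight p (map Not s) = word_weight p s"
proof -
  have "word_weight p s = (\<integral>G. row_weight (env_row (\<lambda>z. G (- fst z, snd z)) 0) 0 s \<partial>env_law p)"
    unfolding word_weight_def
    by (rule integral_env_law_reindex[where \<pi> = "\<lambda>z. (- fst z, snd z)", symmetric])
      (auto simp: inj_on_def prod_eq_iff)
  moreover have "env_row (\<lambda>z. G (- fst z, snd z)) 0 = (\<lambda>i. env_row G 0 (- i))" for G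
    by (auto simp: env_row_def)
  moreover have "row_weight (\<lambda>i. env_row G 0 (- i)) 0 s = row_weight (env_row G 0) 0 (map Not s)" for G
    using row_weight_reflect[of "env_row G 0" 0 s] by simp
  ultimately show ?thesis by (simp add: word_weight_def)
qed

text \<open>This is the i.i.d. property of the words. The induction leaves the starting site
  arbitrary because the next row is entered at \<open>(x + disp s, y - 1)\<close>, a fixed site once
  \<open>s\<close> is fixed. The first factor depends on row \<open>y\<close>, the second on rows
  below it.\<close>

lemma integral_quenched_weight_encode:
  "(\<integral>G. quenched_weight G (x, y) (encode l) \<partial>env_law p) = (\<Prod>s\<leftarrow>l. word_weight p s)"
proof (induction l arbitrary: x y)
  case Nil
  interpret prob_space "env_law p" by (rule prob_space_env_law)
  show ?case by (simp add: prob_space[unfolded space_env_law])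
next
  case (Cons s l)
  let ?x' = "(x + disp s, y - 1)"
  have "(\<integral>G. quenched_weight G (x, y) (encode (s # l)) \<partial>env_law p) =
      (\<integral>G. row_weight (env_row G (y)) (x) s * quenched_weight G ?x' (encode l) \<partial>env_law p)"
  proof (rule integral_cong_AE)
    show "AE G in env_law p. quenched_weight G (x, y) (encode (s # l)) =
        row_weight (env_row G y) x s * quenched_weight G ?x' (encode l)"
      using AE_env_law[of p]
    proof eventually_elim
      case (elim G)
      then show ?case unfolding encode_simps by (intro quenched_weight_encode) blast
    qed
  qed measurable
  also have "\<dots> = (\<integral>G. row_weight (env_row G (y)) (x) s \<partial>env_law p) *
      (\<integral>G. quenched_weight G ?x' (encode l) \<partial>env_law p)"
  proof (rule integral_env_law_indep[where I = "{z. snd z = y}" and J = "{z. snd z < y}"])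
    show "row_weight (env_row G (y)) (x) s = row_weight (env_row G' (y)) (x) s"
      if "\<And>z. z \<in> {z. snd z = y} \<Longrightarrow> G z = G' z" for G G'
      using that by (intro row_weight_cong) (simp add: env_row_def)
    show "quenched_weight G ?x' (encode l) = quenched_weight G' ?x' (encode l)"
      if "\<And>z. z \<in> {z. snd z < y} \<Longrightarrow> G z = G' z" for G G'
      using that by (intro quenched_weight_cong) simp
  qed (auto simp: row_weight_nonneg row_weight_le_1 quenched_weight_nonneg quenched_weight_le_1)
  finally show ?case by (simp add: Cons integral_row_weight)
qed

lemma sets_cylinder: "cylinder \<sigma> \<in> sets (annealed_law \<mu>)"
proof -
  have "{X \<in> space (PiM UNIV (\<lambda>_. count_space UNIV)). \<forall>i\<in>{..length \<sigma>}. X i = endpoint (take i \<sigma>)} \<in>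
      sets (PiM UNIV (\<lambda>_ :: nat. count_space (UNIV :: site set)))"
    by measurable
  then show ?thesis by (simp add: sets_annealed_law cylinder_def space_PiM Ball_def)
qed

lemma emeasure_annealed_law_encode:
  "emeasure (annealed_law (three_or_down_pmf p)) (cylinder (encode l)) = ennreal (\<Prod>s\<leftarrow>l. word_weight p s)"
proof -
  interpret prob_space "env_law p" by (rule prob_space_env_law)
  have sets: "sets (env_law p) = sets (PiM UNIV (\<lambda>_. count_space UNIV))"
    unfolding env_law_def by (rule sets_PiM_cong) auto
  have "emeasure (annealed_law (three_or_down_pmf p)) (cylinder (encode l)) =
      (\<integral>\<^sup>+G. emeasure (quenched_law G) (cylinder (encode l)) \<partial>env_law p)"
    unfolding annealed_law_def env_law_def[symmetric]
  proof (rule emeasure_bind_prob_algebra[where N = "PiM UNIV (\<lambda>_. count_space UNIV)"])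
    show "env_law p \<in> space (prob_algebra (PiM UNIV (\<lambda>_. count_space UNIV)))"
      using sets prob_space_axioms by (simp add: space_prob_algebra)
    show "cylinder (encode l) \<in> sets (PiM UNIV (\<lambda>_. count_space UNIV))"
      using sets_cylinder by (simp add: sets_annealed_law)
  qed (rule measurable_quenched_law)
  also have "\<dots> = ennreal (\<integral>G. quenched_weight G 0 (encode l) \<partial>env_law p)"
    unfolding emeasure_quenched_law_path
    by (intro nn_integral_eq_integral integrable_const_bound[of _ 1])
      (auto simp: quenched_weight_nonneg quenched_weight_le_1)
  finally show ?thesis by (simp only: integral_quenched_weight_encode zero_prod_def)
qed

subsection \<open>The law of a row word\<close>

lemma pmf_replicate_pmf:
  "length l = k \<Longrightarrow> pmf (replicate_pmf k W) l = (\<Prod>s\<leftarrow>l. pmf W s)"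
proof (induction k arbitrary: l)
  case (Suc k)
  then obtain s l' where l: "l = s # l'" "length l' = k" by (cases l) auto
  have "replicate_pmf (Suc k) W = map_pmf (\<lambda>(x, xs). x # xs) (pair_pmf W (replicate_pmf k W))"
    by (simp add: pair_pmf_def map_bind_pmf)
  moreover have "pmf (map_pmf (\<lambda>(x, xs). x # xs) (pair_pmf W (replicate_pmf k W)))
      ((\<lambda>(x, xs). x # xs) (s, l')) = pmf (pair_pmf W (replicate_pmf k W)) (s, l')"
    by (rule pmf_map_inj') (auto simp: inj_on_def)
  ultimately show ?case using Suc.IH[of l'] l by (simp add: pmf_pair)
qed simp

lemma nn_integral_replicate_pmf_prod:
  "(\<integral>\<^sup>+l. (\<Prod>s\<leftarrow>l. h s) \<partial>replicate_pmf k W) = (\<integral>\<^sup>+s. h s \<partial>W) ^ k" for h :: "'a \<Rightarrow> ennreal"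
  by (induction k) (simp_all add: nn_integral_cmult nn_integral_multc)

text \<open>Taylor expansion of order two with Lagrange remainder; the intermediate point lies
  within \<open>\<bar>y\<bar>\<close>, and the factor 1/2 is given away.\<close>

lemma exp_le_quadratic: "exp y \<le> 1 + y + y\<^sup>2 * exp \<bar>y\<bar>" for y :: real
proof -
  obtain t where t: "\<bar>t\<bar> \<le> \<bar>y\<bar>" "exp y = (\<Sum>m<2. y ^ m / fact m) + exp t / fact 2 * y ^ 2"
    using Maclaurin_exp_le[of y 2] by blast
  have "exp t \<le> exp \<bar>y\<bar>" using t(1) by simp
  then have "exp t / 2 \<le> exp \<bar>y\<bar>" using exp_ge_zero[of t] by linarith
  then have "exp t / 2 * y\<^sup>2 \<le> exp \<bar>y\<bar> * y\<^sup>2" by (intro mult_right_mono) auto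
  then show ?thesis using t(2) by (simp add: numeral_2_eq_2 mult.commute)
qed

lemma square_le_exp: "x\<^sup>2 \<le> 2 * exp \<bar>x\<bar>" for x :: real
proof -
  have "1 + \<bar>x\<bar> + \<bar>x\<bar>\<^sup>2 / 2 \<le> exp \<bar>x\<bar>" by (rule exp_lower_Taylor_quadratic) simp
  then show ?thesis by simp
qed

text \<open>Cramer's trick: a negative mean makes the moment generating function smaller than 1 at some
  small positive argument.\<close>

lemma exists_exp_moment_less_1:
  fixes g :: "'a \<Rightarrow> real"
  assumes c: "0 < c" and expint: "integrable (measure_pmf W) (\<lambda>s. exp (c * \<bar>g s\<bar>))"
    and neg: "measure_pmf.expectation W g < 0"
  obtains t where "0 < t" "integrable (measure_pmf W) (\<lambda>s. exp (t * g s))"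
    "measure_pmf.expectation W (\<lambda>s. exp (t * g s)) < 1"
proof -
  \<comment> \<open>\<open>t\<^sup>2 * C\<close> will bound the second-order term. Of the available
    exponent \<open>c\<close>, one half absorbs the square of \<open>g\<close> (whence 8 = 4 * 2,
    from \<open>square_le_exp\<close> at \<open>c / 2 * g s\<close>) and the other half absorbs
    \<open>exp \<bar>t * g s\<bar>\<close>.\<close>
  define C where "C = 8 / c\<^sup>2 * measure_pmf.expectation W (\<lambda>s. exp (c * \<bar>g s\<bar>))"
  define \<epsilon> where "\<epsilon> = - measure_pmf.expectation W g"
  have \<epsilon>: "0 < \<epsilon>" using neg by (simp add: \<epsilon>_def)
  \<comment> \<open>Integrability follows from \<open>neg\<close>: the integral of a non-integrable
    function is 0 by convention, hence not negative.\<close>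
  have intg: "integrable (measure_pmf W) g"
  proof (rule ccontr)
    assume "\<not> ?thesis"
    then have "measure_pmf.expectation W g = 0" by (rule not_integrable_integral_eq)
    with neg show False by simp
  qed
  have "1 \<le> measure_pmf.expectation W (\<lambda>s. exp (c * \<bar>g s\<bar>))"
  proof -
    have "measure_pmf.expectation W (\<lambda>_. 1) \<le> measure_pmf.expectation W (\<lambda>s. exp (c * \<bar>g s\<bar>))"
      using c by (intro integral_mono expint) auto
    then show ?thesis by simp
  qed
  then have C: "0 < C" using c by (simp add: C_def)
  \<comment> \<open>The first bound keeps \<open>exp \<bar>t * g s\<bar>\<close> below half of the
    available exponential moment; the second makes the quadratic error at most half of the linear
    gain \<open>t * \<epsilon>\<close>.\<close>
  define t where "t = min (c / 2) (\<epsilon> / (2 * C))"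
  have t: "0 < t" "t \<le> c / 2" "t * C \<le> \<epsilon> / 2"
    using c \<epsilon> C by (auto simp: t_def min_def field_simps)
  have bound: "exp (t * g s) \<le> 1 + t * g s + t\<^sup>2 * (8 / c\<^sup>2 * exp (c * \<bar>g s\<bar>))" for s
  proof -
    have "(g s)\<^sup>2 = 4 / c\<^sup>2 * (c / 2 * g s)\<^sup>2" using c by (simp add: field_simps power2_eq_square)
    also have "\<dots> \<le> 4 / c\<^sup>2 * (2 * exp \<bar>c / 2 * g s\<bar>)"
      by (intro mult_left_mono square_le_exp) simp
    finally have 1: "(g s)\<^sup>2 \<le> 8 / c\<^sup>2 * exp (c / 2 * \<bar>g s\<bar>)" using c by (simp add: abs_mult)
    have 2: "exp \<bar>t * g s\<bar> \<le> exp (c / 2 * \<bar>g s\<bar>)"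
      unfolding exp_le_cancel_iff abs_mult using t by (intro mult_right_mono) auto
    have "(g s)\<^sup>2 * exp \<bar>t * g s\<bar> \<le> 8 / c\<^sup>2 * exp (c / 2 * \<bar>g s\<bar>) * exp (c / 2 * \<bar>g s\<bar>)"
      by (intro mult_mono 1 2) auto
    also have "\<dots> = 8 / c\<^sup>2 * exp (c * \<bar>g s\<bar>)" by (simp add: exp_add[symmetric])
    finally have "t\<^sup>2 * ((g s)\<^sup>2 * exp \<bar>t * g s\<bar>) \<le> t\<^sup>2 * (8 / c\<^sup>2 * exp (c * \<bar>g s\<bar>))"
      by (intro mult_left_mono) auto
    then show ?thesis using exp_le_quadratic[of "t * g s"] by (simp add: power_mult_distrib mult.assoc)
  qed
  have int: "integrable (measure_pmf W) (\<lambda>s. 1 + t * g s + t\<^sup>2 * (8 / c\<^sup>2 * exp (c * \<bar>g s\<bar>)))"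
    using intg expint by simp
  have int_exp: "integrable (measure_pmf W) (\<lambda>s. exp (t * g s))"
  proof (rule Bochner_Integration.integrable_bound[OF int])
    have "norm (exp (t * g s)) \<le> norm (1 + t * g s + t\<^sup>2 * (8 / c\<^sup>2 * exp (c * \<bar>g s\<bar>)))" for s
      using order_trans[OF bound abs_ge_self, of s] by (simp only: real_norm_def abs_exp_cancel)
    then show "AE s in W. norm (exp (t * g s)) \<le> norm (1 + t * g s + t\<^sup>2 * (8 / c\<^sup>2 * exp (c * \<bar>g s\<bar>)))"
      by simp
  qed simp
  have "measure_pmf.expectation W (\<lambda>s. exp (t * g s)) \<le>
      measure_pmf.expectation W (\<lambda>s. 1 + t * g s + t\<^sup>2 * (8 / c\<^sup>2 * exp (c * \<bar>g s\<bar>)))"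
    by (intro integral_mono int int_exp bound)
  also have "\<dots> = 1 - t * \<epsilon> + t * (t * C)"
    using intg expint by (simp add: C_def \<epsilon>_def power2_eq_square)
  also have "\<dots> \<le> 1 - t * \<epsilon> + t * (\<epsilon> / 2)" using t by (intro add_left_mono mult_left_mono) auto
  also have "\<dots> < 1" using t \<epsilon> by simp
  finally show ?thesis using that t int_exp by blast
qed

text \<open>Exponential Markov inequality: the indicator is at most \<open>exp (t * sum)\<close>,
  whose mean over independent samples is the k-th power of the moment generating function at
  \<open>t\<close>.\<close>

lemma replicate_pmf_Chernoff:
  fixes g :: "'a \<Rightarrow> real"
  assumes "0 < c" "integrable (measure_pmf W) (\<lambda>s. exp (c * \<bar>g s\<bar>))"
    and "measure_pmf.expectation W g < 0"
  shows "\<exists>\<rho>\<in>{0..<1}. \<forall>k. measure (measure_pmf (replicate_pmf k W)) {l. 0 \<le> (\<Sum>s\<leftarrow>l. g s)} \<le> \<rho> ^ k"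
proof -
  obtain t where t: "0 < t" and int: "integrable (measure_pmf W) (\<lambda>s. exp (t * g s))"
    and less: "measure_pmf.expectation W (\<lambda>s. exp (t * g s)) < 1"
    using exists_exp_moment_less_1[OF assms] .
  define \<rho> where "\<rho> = measure_pmf.expectation W (\<lambda>s. exp (t * g s))"
  have \<rho>: "0 \<le> \<rho>" unfolding \<rho>_def by simp
  have "measure (measure_pmf (replicate_pmf k W)) {l. 0 \<le> (\<Sum>s\<leftarrow>l. g s)} \<le> \<rho> ^ k" for k
  proof -
    have prod: "(\<Prod>s\<leftarrow>l. ennreal (exp (t * g s))) = ennreal (exp (t * (\<Sum>s\<leftarrow>l. g s)))" for l
      by (induction l) (simp_all add: ennreal_mult[symmetric] exp_add distrib_left)
    have "emeasure (measure_pmf (replicate_pmf k W)) {l. 0 \<le> (\<Sum>s\<leftarrow>l. g s)} =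
        (\<integral>\<^sup>+l. indicator {l. 0 \<le> (\<Sum>s\<leftarrow>l. g s)} l \<partial>replicate_pmf k W)"
      by simp
    also have "\<dots> \<le> (\<integral>\<^sup>+l. (\<Prod>s\<leftarrow>l. ennreal (exp (t * g s))) \<partial>replicate_pmf k W)"
      unfolding prod using t
      by (intro nn_integral_mono) (auto simp: indicator_def)
    also have "\<dots> = ennreal \<rho> ^ k"
      unfolding nn_integral_replicate_pmf_prod \<rho>_def using int
      by (subst nn_integral_eq_integral) auto
    finally show ?thesis using \<rho> by (simp add: measure_pmf.emeasure_eq_measure ennreal_power)
  qed
  with \<rho> less show ?thesis by (intro bexI[of _ \<rho>]) (simp_all add: \<rho>_def)
qed

section \<open>The annealed law of a word and of its length\<close>

definition exit_law :: "real \<Rightarrow> nat \<Rightarrow> real" where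
  "exit_law p n = (\<integral>G. exit_prob (env_row G 0) n 0 \<partial>env_law p)"

lemma measurable_exit_prob [measurable]:
  "(\<lambda>G. exit_prob (env_row G y) n x) \<in> borel_measurable (env_law p)"
  by (induction n arbitrary: x) simp_all

lemma integrable_env_law_bounded:
  fixes f :: "environment \<Rightarrow> real"
  assumes "f \<in> borel_measurable (env_law p)" "\<And>G. 0 \<le> f G" "\<And>G. f G \<le> B"
  shows "integrable (env_law p) f"
proof -
  interpret prob_space "env_law p" by (rule prob_space_env_law)
  show ?thesis using assms by (intro integrable_const_bound[of _ B]) auto
qed

lemma integrable_exit_prob: "integrable (env_law p) (\<lambda>G. exit_prob (env_row G y) n x)"
  by (rule integrable_env_law_bounded[OF measurable_exit_prob exit_prob_nonneg exit_prob_le])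

lemma integrable_row_weight: "integrable (env_law p) (\<lambda>G. row_weight (env_row G y) x s)"
  by (rule integrable_env_law_bounded[OF measurable_row_weight row_weight_nonneg row_weight_le_1])

lemma measure_env_law_UNIV [simp]: "measure (env_law p) UNIV = 1"
  using prob_space.prob_space[OF prob_space_env_law[of p]] by simp

lemma integrable_env_law_const [simp]: "integrable (env_law p) (\<lambda>G. c :: real)"
proof -
  interpret prob_space "env_law p" by (rule prob_space_env_law)
  show ?thesis by simp
qed

lemma word_weight_nonneg: "0 \<le> word_weight p s"
  by (simp add: word_weight_def row_weight_nonneg)

lemma sum_word_weight: "(\<Sum>s | length s = n. word_weight p s) = exit_law p n"
  unfolding word_weight_def exit_law_def sum_row_weight[symmetric]
  by (rule Bochner_Integration.integral_sum[symmetric, OF integrable_row_weight])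

lemma exit_law_nonneg: "0 \<le> exit_law p n"
  by (simp add: exit_law_def exit_prob_nonneg)

lemma exit_law_le: "exit_law p n \<le> (2 / 3) ^ n"
proof -
  have "exit_law p n \<le> (\<integral>G. (2 / 3) ^ n \<partial>env_law p)"
    unfolding exit_law_def by (intro integral_mono integrable_exit_prob exit_prob_le) simp
  then show ?thesis by simp
qed

lemma exit_law_sums: "exit_law p sums 1"
proof -
  have eq: "1 - (\<Sum>i<n. exit_law p i) = (\<integral>G. 1 - (\<Sum>i<n. exit_prob (env_row G 0) i 0) \<partial>env_law p)" for n
    unfolding exit_law_def by (simp add: integrable_exit_prob)
  have "0 \<le> 1 - (\<Sum>i<n. exit_law p i)" for n
    unfolding eq using survival_bound by (intro integral_nonneg_AE) auto
  moreover have "1 - (\<Sum>i<n. exit_law p i) \<le> (2 / 3) ^ n" for n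
  proof -
    have "1 - (\<Sum>i<n. exit_law p i) \<le> (\<integral>G. (2 / 3) ^ n \<partial>env_law p)"
      unfolding eq using survival_bound
      by (intro integral_mono) (auto simp: integrable_exit_prob)
    then show ?thesis by simp
  qed
  ultimately have "(\<lambda>n. 1 - (\<Sum>i<n. exit_law p i)) \<longlonglongrightarrow> 0"
    by (intro tendsto_sandwich[OF _ _ tendsto_const LIMSEQ_realpow_zero[of "2 / 3 :: real"]]) auto
  from tendsto_diff[OF tendsto_const[of 1] this] show ?thesis by (simp add: sums_def)
qed

text \<open>Grouping words by length reduces sums over all words to series in \<open>n\<close>,
  where the geometric bounds on \<open>exit_law\<close> are available.\<close>

lemma nn_integral_bool_lists:
  fixes f :: "bool list \<Rightarrow> real"
  assumes f: "\<And>s. 0 \<le> f s" and g: "\<And>n. 0 \<le> g n"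
  shows "(\<integral>\<^sup>+s. ennreal (g (length s) * f s) \<partial>count_space UNIV) =
    (\<Sum>n. ennreal (g n * (\<Sum>s | length s = n. f s)))"
proof -
  have "(\<Sum>n. ennreal (g n * f s) * indicator {s. length s = n} s) = ennreal (g (length s) * f s)" for s
    by (subst suminf_finite[of "{length s}"]) auto
  then have "(\<integral>\<^sup>+s. ennreal (g (length s) * f s) \<partial>count_space UNIV) =
      (\<integral>\<^sup>+s. (\<Sum>n. ennreal (g n * f s) * indicator {s. length s = n} s) \<partial>count_space UNIV)"
    by simp
  also have "\<dots> = (\<Sum>n. \<integral>\<^sup>+s. ennreal (g n * f s) * indicator {s. length s = n} s \<partial>count_space UNIV)"
    by (rule nn_integral_suminf) simp
  also have "\<dots> = (\<Sum>n. ennreal (g n * (\<Sum>s | length s = n. f s)))"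
  proof (rule suminf_cong)
    fix n
    have "(\<integral>\<^sup>+s. ennreal (g n * f s) * indicator {s. length s = n} s \<partial>count_space UNIV) =
        (\<integral>\<^sup>+s. ennreal (g n * f s) \<partial>count_space {s. length s = n})"
      by (rule nn_integral_count_space_indicator[symmetric], unfold NO_MATCH_def, rule TrueI)
    also have "\<dots> = (\<Sum>s | length s = n. ennreal (g n * f s))"
      by (rule nn_integral_count_space_finite[OF finite_bool_lists])
    also have "\<dots> = ennreal (\<Sum>s | length s = n. g n * f s)"
      using f g by (intro sum_ennreal) simp
    also have "(\<Sum>s | length s = n. g n * f s) = g n * (\<Sum>s | length s = n. f s)"
      by (rule sum_distrib_left[symmetric])
    finally show "(\<integral>\<^sup>+s. ennreal (g n * f s) * indicator {s. length s = n} s \<partial>count_space UNIV) =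
        ennreal (g n * (\<Sum>s | length s = n. f s))" .
  qed
  finally show ?thesis .
qed

text \<open>Meaningful because the weights have total mass 1, which comes from
  \<open>exit_law_sums\<close>: almost surely the walk leaves its row.\<close>

definition word_pmf :: "real \<Rightarrow> bool list pmf" where "word_pmf p = embed_pmf (word_weight p)"

lemma pmf_word_pmf: "pmf (word_pmf p) s = word_weight p s"
  unfolding word_pmf_def
proof (rule pmf_embed_pmf)
  show "0 \<le> word_weight p s" for s by (rule word_weight_nonneg)
  show "(\<integral>\<^sup>+s. ennreal (word_weight p s) \<partial>count_space UNIV) = 1"
    using nn_integral_bool_lists[of "word_weight p" "\<lambda>_. 1"] suminf_ennreal_eq[OF exit_law_nonneg exit_law_sums]
    by (simp add: word_weight_nonneg sum_word_weight)
qed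

lemma nn_integral_word_pmf:
  assumes "\<And>n. 0 \<le> g n"
  shows "(\<integral>\<^sup>+s. ennreal (g (length s)) \<partial>word_pmf p) = (\<Sum>n. ennreal (g n * exit_law p n))"
  using nn_integral_bool_lists[of "word_weight p" g] assms
  by (simp add: nn_integral_measure_pmf pmf_word_pmf word_weight_nonneg sum_word_weight
      ennreal_mult'[symmetric] mult.commute)

lemma has_bochner_integral_word_pmf:
  assumes g: "\<And>n. 0 \<le> g n" and sums: "(\<lambda>n. g n * exit_law p n) sums S"
  shows "has_bochner_integral (word_pmf p) (\<lambda>s. g (length s)) S"
proof (rule has_bochner_integral_nn_integral)
  have "0 \<le> S" using sums_le[OF _ sums_zero sums] g exit_law_nonneg by auto
  then show "0 \<le> S" .
  show "(\<integral>\<^sup>+s. ennreal (g (length s)) \<partial>word_pmf p) = ennreal S"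
    unfolding nn_integral_word_pmf[of g, OF g] using g exit_law_nonneg by (intro suminf_ennreal_eq sums) simp
qed (use g in auto)

lemma map_not_word_pmf: "map_pmf (map Not) (word_pmf p) = word_pmf p"
proof (rule pmf_eqI)
  fix s
  have "inj (map Not)" by (rule injI) (simp add: inj_map_eq_map inj_def)
  then have "pmf (map_pmf (map Not) (word_pmf p)) (map Not (map Not s)) = pmf (word_pmf p) (map Not s)"
    by (rule pmf_map_inj')
  then show "pmf (map_pmf (map Not) (word_pmf p)) s = pmf (word_pmf p) s"
    by (simp add: pmf_word_pmf word_weight_reflect o_def)
qed

lemma disp_map_Not: "disp (map Not s) = - disp s"
  by (induction s) (auto simp: sign_def)

lemma abs_disp_le: "\<bar>disp s\<bar> \<le> int (length s)"
  by (induction s) (auto simp: sign_def)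

lemma expectation_disp: "measure_pmf.expectation (word_pmf p) (\<lambda>s. real_of_int (disp s)) = 0"
proof -
  have "measure_pmf.expectation (word_pmf p) (\<lambda>s. real_of_int (disp s)) =
      measure_pmf.expectation (map_pmf (map Not) (word_pmf p)) (\<lambda>s. real_of_int (disp s))"
    by (simp only: map_not_word_pmf)
  also have "\<dots> = - measure_pmf.expectation (word_pmf p) (\<lambda>s. real_of_int (disp s))"
    by (simp add: disp_map_Not)
  finally show ?thesis by simp
qed

text \<open>The rate 1/10 is chosen so that the growth of the exponential is beaten by the decay of
  \<open>exit_law\<close>: 5/4 * 2/3 = 5/6 < 1.\<close>

lemma exp_tenth_le: "exp (1 / 10 :: real) \<le> 5 / 4"
proof -
  have "exp (1 / 10 :: real) \<le> 1 + 1 / 10 + (1 / 10)\<^sup>2" by (rule exp_bound) auto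
  then show ?thesis by (simp add: power2_eq_square)
qed

lemma integrable_exp_length: "integrable (word_pmf p) (\<lambda>s. exp (real (length s) / 10))"
proof -
  have "summable (\<lambda>n. exp (real n / 10) * exit_law p n)"
  proof (rule summable_comparison_test)
    have "exp (real n / 10) * exit_law p n \<le> (5 / 6) ^ n" for n
    proof -
      have "exp (real n / 10) * exit_law p n \<le> (5 / 4) ^ n * (2 / 3) ^ n"
      proof (intro mult_mono exit_law_le)
        have "exp (real n / 10) = exp (1 / 10) ^ n" by (simp add: exp_of_nat_mult[symmetric])
        then show "exp (real n / 10) \<le> (5 / 4) ^ n" using exp_tenth_le by (simp add: power_mono)
      qed (auto simp: exit_law_nonneg)
      then show ?thesis by (simp add: power_mult_distrib[symmetric])
    qed
    then show "\<exists>N. \<forall>n\<ge>N. norm (exp (real n / 10) * exit_law p n) \<le> (5 / 6) ^ n"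
      by (simp add: exit_law_nonneg)
    show "summable (\<lambda>n. (5 / 6 :: real) ^ n)" by simp
  qed
  from has_bochner_integral_word_pmf[OF _ summable_sums[OF this]] show ?thesis
    by (auto simp: has_bochner_integral_iff)
qed

lemma integrable_exp_abs:
  assumes "\<And>s. \<bar>g s\<bar> \<le> real (length s) + B"
  shows "integrable (word_pmf p) (\<lambda>s. exp (1 / 10 * \<bar>g s\<bar>))"
proof (rule Bochner_Integration.integrable_bound)
  show "integrable (word_pmf p) (\<lambda>s. exp (B / 10) * exp (real (length s) / 10))"
    by (intro integrable_mult_right integrable_exp_length)
  show "AE s in word_pmf p. norm (exp (1 / 10 * \<bar>g s\<bar>)) \<le> norm (exp (B / 10) * exp (real (length s) / 10))"
    using assms by (auto simp: exp_add[symmetric] add_divide_distrib[symmetric] add.commute intro!: AE_pmfI)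
qed simp

lemma integrable_of_exp:
  fixes g :: "'a \<Rightarrow> real"
  assumes "integrable (measure_pmf W) (\<lambda>s. exp (1 / 10 * \<bar>g s\<bar>))"
  shows "integrable (measure_pmf W) g"
proof (rule Bochner_Integration.integrable_bound)
  show "integrable (measure_pmf W) (\<lambda>s. 10 * exp (1 / 10 * \<bar>g s\<bar>))"
    using assms by simp
  have "\<bar>g s\<bar> \<le> 10 * exp (1 / 10 * \<bar>g s\<bar>)" for s
    using exp_ge_add_one_self[of "1 / 10 * \<bar>g s\<bar>"] by linarith
  then show "AE s in measure_pmf W. norm (g s) \<le> norm (10 * exp (1 / 10 * \<bar>g s\<bar>))" by simp
qed simp

subsection \<open>Limit theorems along levels\<close>

lemma map_Some_None_inject:
  "map Some s @ None # \<sigma> = map Some s' @ None # \<sigma>' \<Longrightarrow> s = s' \<and> \<sigma> = \<sigma>'"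
proof (induction s arbitrary: s')
  case Nil then show ?case by (cases s') auto
next
  case (Cons b s) then show ?case by (cases s') auto
qed

text \<open>Each \<open>None\<close> terminates a word, so a code can be read off from the left;
  with equally many words, trailing steps cannot cause ambiguity.\<close>

lemma encode_append_inject:
  "length l = length l' \<Longrightarrow> encode l @ \<sigma> = encode l' @ \<sigma>' \<Longrightarrow> l = l'"
proof (induction l l' rule: list_induct2)
  case (Cons s l s' l')
  from Cons.prems have "map Some s @ None # (encode l @ \<sigma>) = map Some s' @ None # (encode l' @ \<sigma>')" by simp
  from map_Some_None_inject[OF this] Cons.IH show ?case by simp
qed simp

lemma inj_step_vec: "step_vec c = step_vec c' \<Longrightarrow> c = c'"
  by (cases c; cases c') (auto simp: sign_def split: if_splits)

lemma cylinder_nth: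
  assumes "X \<in> cylinder \<sigma>" "i < length \<sigma>"
  shows "X (Suc i) = X i + step_vec (\<sigma> ! i)"
  using assms by (simp add: cylinder_def take_Suc_conv_app_nth endpoint_append)

lemma cylinder_prefix:
  assumes X: "X \<in> cylinder \<sigma>" "X \<in> cylinder \<sigma>'" and le: "length \<sigma> \<le> length \<sigma>'"
  shows "\<sigma>' = \<sigma> @ drop (length \<sigma>) \<sigma>'"
proof -
  have "\<sigma> ! i = take (length \<sigma>) \<sigma>' ! i" if "i < length \<sigma>" for i
    using cylinder_nth[OF X(1) that] cylinder_nth[OF X(2), of i] that le by (auto intro: inj_step_vec)
  then have "\<sigma> = take (length \<sigma>) \<sigma>'" using le by (intro nth_equalityI) auto
  then show ?thesis by (metis append_take_drop_id)
qed

text \<open>Two lists with equally many words may have codes of different lengths. The path forces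
  the shorter code to be a prefix of the longer one, and unique decoding then gives
  equality.\<close>

lemma cylinder_encode_unique:
  assumes "X \<in> cylinder (encode l)" "X \<in> cylinder (encode l')" "length l = length l'"
  shows "l = l'"
proof (cases "length (encode l) \<le> length (encode l')")
  case True
  from cylinder_prefix[OF assms(1,2) True] obtain \<sigma> where "encode l' = encode l @ \<sigma>" by blast
  then show ?thesis using encode_append_inject[OF assms(3), of \<sigma> "[]"] by simp
next
  case False
  from cylinder_prefix[OF assms(2,1)] False obtain \<sigma> where "encode l = encode l' @ \<sigma>" by (metis nle_le)
  then show ?thesis using encode_append_inject[OF assms(3), of "[]" \<sigma>] by simp
qed

text \<open>The bridge between the walk and i.i.d. words: the cylinders are disjoint, and each has
  the probability that \<open>replicate_pmf\<close> gives to its list. Events about the first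
  \<open>k\<close> rows can thus be computed with \<open>word_pmf\<close> alone.\<close>

lemma emeasure_annealed_law_words:
  assumes I: "\<And>l. l \<in> I \<Longrightarrow> length l = k"
  shows "emeasure (annealed_law (three_or_down_pmf p)) (\<Union>l\<in>I. cylinder (encode l)) =
    emeasure (measure_pmf (replicate_pmf k (word_pmf p))) I"
proof -
  have "emeasure (annealed_law (three_or_down_pmf p)) (\<Union>l\<in>I. cylinder (encode l)) =
      (\<integral>\<^sup>+l. emeasure (annealed_law (three_or_down_pmf p)) (cylinder (encode l)) \<partial>count_space I)"
  proof (rule emeasure_UN_countable)
    show "disjoint_family_on (\<lambda>l. cylinder (encode l)) I"
      using cylinder_encode_unique I by (fastforce simp: disjoint_family_on_def)
  qed (auto simp: sets_cylinder)
  also have "\<dots> = (\<integral>\<^sup>+l. pmf (replicate_pmf k (word_pmf p)) l \<partial>count_space I)"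
    using I by (intro nn_integral_cong)
      (simp add: emeasure_annealed_law_encode pmf_replicate_pmf pmf_word_pmf)
  also have "\<dots> = emeasure (measure_pmf (replicate_pmf k (word_pmf p))) I"
    by (rule nn_integral_pmf)
  finally show ?thesis .
qed

lemma space_annealed_law [simp]: "space (annealed_law \<mu>) = UNIV"
  using sets_eq_imp_space_eq[OF sets_annealed_law[of \<mu>]] by (simp add: space_PiM)

lemma sets_UN_cylinder: "(\<Union>l\<in>I. cylinder (encode l)) \<in> sets (annealed_law \<mu>)"
  by (intro sets.countable_UN'') (auto simp: sets_cylinder)

text \<open>The lists of length \<open>k\<close> carry all the mass of \<open>replicate_pmf\<close>,
  so almost every path completes its first \<open>k\<close> rows.\<close>

lemma AE_annealed_law_words:
  "AE X in annealed_law (three_or_down_pmf p). \<forall>k. \<exists>l. length l = k \<and> X \<in> cylinder (encode l)"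
  unfolding AE_all_countable
proof
  fix k
  interpret prob_space "annealed_law (three_or_down_pmf p)" by (rule prob_space_annealed_law)
  have "emeasure (annealed_law (three_or_down_pmf p)) (\<Union>l\<in>{l. length l = k}. cylinder (encode l)) =
      emeasure (measure_pmf (replicate_pmf k (word_pmf p))) {l. length l = k}"
    by (rule emeasure_annealed_law_words) simp
  also have "\<dots> = 1"
    by (rule measure_pmf.emeasure_eq_1_AE) (auto simp: set_replicate_pmf intro!: AE_pmfI)
  finally have "prob (\<Union>l\<in>{l. length l = k}. cylinder (encode l)) = 1" by (simp only: measure_def enn2real_1)
  from AE_prob_1[OF this] show "AE X in annealed_law (three_or_down_pmf p). \<exists>l. length l = k \<and> X \<in> cylinder (encode l)"
    by eventually_elim auto
qed

text \<open>The Chernoff bound is summable in \<open>k\<close>, so Borel-Cantelli applies to the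
  events \<open>bad k\<close>.\<close>

lemma AE_eventually_sum_less:
  fixes g :: "bool list \<Rightarrow> real"
  assumes "\<And>s. \<bar>g s\<bar> \<le> real (length s) + B"
    and "measure_pmf.expectation (word_pmf p) g < 0"
  shows "AE X in annealed_law (three_or_down_pmf p).
    \<forall>\<^sub>F k in sequentially. \<forall>l. length l = k \<and> X \<in> cylinder (encode l) \<longrightarrow> (\<Sum>s\<leftarrow>l. g s) < 0"
proof -
  let ?M = "annealed_law (three_or_down_pmf p)"
  interpret prob_space ?M by (rule prob_space_annealed_law)
  have tenth: "0 < (1 / 10 :: real)" by simp
  have exp_int: "integrable (word_pmf p) (\<lambda>s. exp (1 / 10 * \<bar>g s\<bar>))"
    by (rule integrable_exp_abs) (rule assms(1))
  obtain \<rho> where \<rho>: "0 \<le> \<rho>" "\<rho> < 1"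
    "\<And>k. measure (measure_pmf (replicate_pmf k (word_pmf p))) {l. 0 \<le> (\<Sum>s\<leftarrow>l. g s)} \<le> \<rho> ^ k"
    using replicate_pmf_Chernoff[OF tenth exp_int assms(2)] by auto
  define bad where "bad k = (\<Union>l\<in>{l. length l = k \<and> 0 \<le> (\<Sum>s\<leftarrow>l. g s)}. cylinder (encode l))" for k
  have bad: "measure ?M (bad k) \<le> \<rho> ^ k" for k
  proof -
    have "measure ?M (bad k) = measure (measure_pmf (replicate_pmf k (word_pmf p)))
        {l. length l = k \<and> 0 \<le> (\<Sum>s\<leftarrow>l. g s)}"
      unfolding bad_def measure_def by (subst emeasure_annealed_law_words[where k = k]) auto
    also have "\<dots> \<le> measure (measure_pmf (replicate_pmf k (word_pmf p))) {l. 0 \<le> (\<Sum>s\<leftarrow>l. g s)}"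
      by (intro measure_pmf.finite_measure_mono) auto
    finally show ?thesis using \<rho>(3)[of k] by simp
  qed
  have "AE X in ?M. \<forall>\<^sub>F k in sequentially. X \<in> space ?M - bad k"
  proof (rule borel_cantelli_AE1)
    show "bad k \<in> sets ?M" for k unfolding bad_def by (rule sets_UN_cylinder)
    show "emeasure ?M (bad k) < \<infinity>" for k by (simp add: emeasure_eq_measure)
    show "summable (\<lambda>k. measure ?M (bad k))"
      by (rule summable_comparison_test[OF _ summable_geometric[of \<rho>]])
        (use bad \<rho> in auto)
  qed
  then show ?thesis
  proof eventually_elim
    case (elim X)
    then show ?case
    proof (rule eventually_mono, intro allI impI)
      fix k l assume "X \<in> space ?M - bad k" "length l = k \<and> X \<in> cylinder (encode l)"
      then have "\<not> 0 \<le> (\<Sum>s\<leftarrow>l. g s)" by (auto simp: bad_def)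
      then show "(\<Sum>s\<leftarrow>l. g s) < 0" by simp
    qed
  qed
qed

text \<open>A strong law from one-sided bounds. The decomposition \<open>L\<close> is quantified
  inside the almost sure event, so that it can be chosen path by path.\<close>

lemma AE_word_averages:
  fixes f :: "bool list \<Rightarrow> real"
  assumes f: "\<And>s. \<bar>f s\<bar> \<le> real (length s) + B" and m: "measure_pmf.expectation (word_pmf p) f = m"
  shows "AE X in annealed_law (three_or_down_pmf p). \<forall>L.
    (\<forall>k. length (L k) = k \<and> X \<in> cylinder (encode (L k))) \<longrightarrow> (\<lambda>k. (\<Sum>s\<leftarrow>L k. f s) / real k) \<longlonglongrightarrow> m"
proof -
  have int: "integrable (measure_pmf (word_pmf p)) f"
    by (rule integrable_of_exp[OF integrable_exp_abs]) (rule f)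
  \<comment> \<open>The signs \<open>c = 1\<close> and \<open>c = -1\<close> give the upper and the
    lower bound; subtracting \<open>1 / Suc j\<close> makes the mean strictly negative, and
    countably many \<open>j\<close> suffice.\<close>
  have *: "AE X in annealed_law (three_or_down_pmf p). \<forall>\<^sub>F k in sequentially.
      \<forall>l. length l = k \<and> X \<in> cylinder (encode l) \<longrightarrow> (\<Sum>s\<leftarrow>l. c * (f s - m) - 1 / real (Suc j)) < 0"
    if c: "\<bar>c\<bar> = 1" for c j
  proof (rule AE_eventually_sum_less)
    show "\<bar>c * (f s - m) - 1 / real (Suc j)\<bar> \<le> real (length s) + (B + \<bar>m\<bar> + 1)" for s
    proof -
      have "\<bar>c * (f s - m)\<bar> = \<bar>f s - m\<bar>" using c by (simp add: abs_mult)
      moreover have "\<bar>1 / real (Suc j)\<bar> \<le> 1" by simp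
      ultimately show ?thesis using f[of s] by linarith
    qed
    show "measure_pmf.expectation (word_pmf p) (\<lambda>s. c * (f s - m) - 1 / real (Suc j)) < 0"
      using int m by simp
  qed
  have "AE X in annealed_law (three_or_down_pmf p). \<forall>j. \<forall>\<^sub>F k in sequentially.
      \<forall>l. length l = k \<and> X \<in> cylinder (encode l) \<longrightarrow> (\<Sum>s\<leftarrow>l. 1 * (f s - m) - 1 / real (Suc j)) < 0"
    unfolding AE_all_countable by (intro allI *) simp
  moreover have "AE X in annealed_law (three_or_down_pmf p). \<forall>j. \<forall>\<^sub>F k in sequentially.
      \<forall>l. length l = k \<and> X \<in> cylinder (encode l) \<longrightarrow> (\<Sum>s\<leftarrow>l. - 1 * (f s - m) - 1 / real (Suc j)) < 0"
    unfolding AE_all_countable by (intro allI *) simp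
  ultimately show ?thesis
  proof eventually_elim
    case (elim X)
    show ?case
    proof (intro allI impI)
      fix L assume L: "\<forall>k. length (L k) = k \<and> X \<in> cylinder (encode (L k))"
      have sum: "(\<Sum>s\<leftarrow>L k. c * (f s - m) - d) = c * ((\<Sum>s\<leftarrow>L k. f s) - real k * m) - real k * d" for c d k
      proof -
        have "(\<Sum>s\<leftarrow>l. c * (f s - m) - d) = c * ((\<Sum>s\<leftarrow>l. f s) - real (length l) * m) - real (length l) * d" for l
          by (induction l) (simp_all add: algebra_simps)
        then show ?thesis using L by simp
      qed
      show "(\<lambda>k. (\<Sum>s\<leftarrow>L k. f s) / real k) \<longlonglongrightarrow> m"
      proof (rule tendstoI)
        fix e :: real assume "0 < e"
        then obtain j where j: "1 / real (Suc j) < e" using nat_approx_posE by (metis)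
        show "\<forall>\<^sub>F k in sequentially. dist ((\<Sum>s\<leftarrow>L k. f s) / real k) m < e"
          using elim[THEN spec[of _ j]] eventually_gt_at_top[of 0]
        proof eventually_elim
          case (elim k)
          define S where "S = (\<Sum>s\<leftarrow>L k. f s)"
          have k: "0 < real k" using elim by simp
          have "S - real k * m < real k * (1 / real (Suc j))" "- (S - real k * m) < real k * (1 / real (Suc j))"
            using elim(1)[rule_format, of "L k"] elim(2)[rule_format, of "L k"] L
            unfolding sum S_def by auto
          then have "\<bar>S - real k * m\<bar> < real k * (1 / real (Suc j))" by linarith
          also have "\<dots> < real k * e" using j k by (intro mult_strict_left_mono) auto
          finally have "\<bar>S - real k * m\<bar> < real k * e" .
          moreover have "S / real k - m = (S - real k * m) / real k" using k by (simp add: field_simps)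
          ultimately have "\<bar>S / real k - m\<bar> < e" using k by (simp add: field_simps)
          then show ?case by (simp add: dist_real_def S_def)
        qed
      qed
    qed
  qed
qed

subsection \<open>From levels to times\<close>

lemma length_encode: "length (encode l) = (\<Sum>s\<leftarrow>l. length s + 1)"
  by (induction l) simp_all

lemma length_le_length_encode: "length l \<le> length (encode l)"
  by (induction l) simp_all

lemma endpoint_map_Some: "endpoint (map Some s) = (disp s, 0)"
  by (induction s) (simp_all add: zero_prod_def)

lemma endpoint_encode: "endpoint (encode l) = ((\<Sum>s\<leftarrow>l. disp s), - int (length l))"
  by (induction l) (simp_all add: endpoint_append endpoint_map_Some zero_prod_def)

lemma encode_eq_Nil_iff [simp]: "encode l = [] \<longleftrightarrow> l = []"
  by (cases l) auto

lemma last_encode: "l \<noteq> [] \<Longrightarrow> last (encode l) = None"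
  by (induction l) auto

text \<open>The level \<open>- k\<close> is the one occupied during the times \<open>\<tau> k \<le> n < \<tau> (k + 1)\<close>.\<close>

lemma walk_level_bounds:
  assumes L: "\<And>k. length (L k) = k" "\<And>k. X \<in> cylinder (encode (L k))"
  defines "\<tau> \<equiv> \<lambda>k. length (encode (L k))" and "k \<equiv> \<lambda>n. nat (- snd (X n))"
  shows "snd (X n) = - int (k n)"
    and "\<tau> (k n) \<le> n"
    and "n < \<tau> (Suc (k n))"
    and "\<bar>fst (X n)\<bar> \<le> \<bar>\<Sum>s\<leftarrow>L (k n). disp s\<bar> + (int (\<tau> (Suc (k n))) - int (\<tau> (k n)))"
    and "filterlim k at_top sequentially"
proof -
  have step: "\<exists>c. X (Suc i) = X i + step_vec c" for i
    using cylinder_nth[OF L(2)[of "Suc i"], of i] length_le_length_encode[of "L (Suc i)"] L(1)[of "Suc i"] by auto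
  have at_\<tau>: "X (\<tau> k) = ((\<Sum>s\<leftarrow>L k. disp s), - int k)" for k
  proof -
    have "X (\<tau> k) = endpoint (take (\<tau> k) (encode (L k)))" using L(2)[of k] by (simp add: cylinder_def \<tau>_def)
    then show ?thesis by (simp add: \<tau>_def endpoint_encode L(1))
  qed
  have L0: "L 0 = []" using L(1)[of 0] by simp
  then have X0: "snd (X 0) = 0" "\<tau> 0 = 0" using at_\<tau>[of 0] by (simp_all add: \<tau>_def)
  have mono: "snd (X j) \<le> snd (X i)" if "i \<le> j" for i j
    using that
  proof (induction rule: dec_induct)
    case (step j)
    obtain c where "X (Suc j) = X j + step_vec c" using \<open>\<And>i. \<exists>c. X (Suc i) = X i + step_vec c\<close> by blast
    then show ?case using step.IH by (cases c) auto
  qed simp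
  have drift: "\<bar>fst (X j) - fst (X i)\<bar> \<le> int j - int i" if "i \<le> j" for i j
    using that
  proof (induction rule: dec_induct)
    case (step j)
    obtain c where "X (Suc j) = X j + step_vec c" using \<open>\<And>i. \<exists>c. X (Suc i) = X i + step_vec c\<close> by blast
    then show ?case using step.IH by (cases c) (auto simp: sign_def)
  qed simp
  \<comment> \<open>The code ends with a down step, so one time unit before
    \<open>\<tau> (Suc k)\<close> the walk is still on the level above.\<close>
  have before: "snd (X (\<tau> (Suc k) - 1)) = - int k" for k
  proof -
    have ne: "L (Suc k) \<noteq> []" using L(1)[of "Suc k"] by auto
    then have "0 < \<tau> (Suc k)" by (simp add: \<tau>_def)
    then have "X (\<tau> (Suc k)) = X (\<tau> (Suc k) - 1) + step_vec (encode (L (Suc k)) ! (\<tau> (Suc k) - 1))"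
      using cylinder_nth[OF L(2)[of "Suc k"], of "\<tau> (Suc k) - 1"] by (simp add: \<tau>_def)
    also have "encode (L (Suc k)) ! (\<tau> (Suc k) - 1) = None"
      using last_encode[OF ne] ne by (simp add: \<tau>_def last_conv_nth)
    finally show ?thesis using at_\<tau>[of "Suc k"] by (simp add: prod_eq_iff)
  qed
  have k: "snd (X n) = - int (k n)" for n using mono[of 0 n] X0 by (simp add: k_def)
  then show "snd (X n) = - int (k n)" .
  show 1: "\<tau> (k n) \<le> n"
  proof (cases "k n")
    case (Suc k')
    show ?thesis
    proof (rule ccontr)
      assume "\<not> ?thesis"
      then have "n \<le> \<tau> (Suc k') - 1" using Suc by simp
      from mono[OF this] before[of k'] k[of n] Suc show False by simp
    qed
  qed (simp add: X0)
  show 2: "n < \<tau> (Suc (k n))"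
  proof (rule ccontr)
    assume "\<not> ?thesis"
    then have "\<tau> (Suc (k n)) \<le> n" by simp
    from mono[OF this] at_\<tau>[of "Suc (k n)"] k[of n] show False by simp
  qed
  show "\<bar>fst (X n)\<bar> \<le> \<bar>\<Sum>s\<leftarrow>L (k n). disp s\<bar> + (int (\<tau> (Suc (k n))) - int (\<tau> (k n)))"
    using drift[OF 1] at_\<tau>[of "k n"] 2 by simp
  show "filterlim k at_top sequentially"
    unfolding filterlim_at_top eventually_sequentially
  proof (intro allI exI impI)
    fix K n assume "\<tau> K \<le> n"
    from mono[OF this] at_\<tau>[of K] k[of n] show "K \<le> k n" by simp
  qed
qed

text \<open>Dividing \<open>\<tau> (k n) \<le> n < \<tau> (Suc (k n))\<close> by \<open>k n\<close>
  squeezes \<open>n / k n\<close> to \<open>m\<close>; inverting gives the vertical speed. Inside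
  the current row the horizontal displacement is at most the duration of that row, and this is
  negligible because the two bounds have the same limit after division.\<close>

lemma walk_limit:
  assumes L: "\<And>k. length (L k) = k" "\<And>k. X \<in> cylinder (encode (L k))"
    and time: "(\<lambda>k. (\<Sum>s\<leftarrow>L k. real (length s + 1)) / real k) \<longlonglongrightarrow> m"
    and disp: "(\<lambda>k. (\<Sum>s\<leftarrow>L k. real_of_int (disp s)) / real k) \<longlonglongrightarrow> 0"
    and m: "0 < m"
  shows "(\<lambda>n. (1 / real n) *\<^sub>R real_site (X n)) \<longlonglongrightarrow> (0, - 1 / m)"
proof -
  define \<tau> where "\<tau> k = length (encode (L k))" for k
  define k where "k n = nat (- snd (X n))" for n
  define d where "d k = (\<Sum>s\<leftarrow>L k. disp s)" for k
  note bounds = walk_level_bounds[OF L, folded \<tau>_def k_def d_def]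
  have \<tau>: "real (\<tau> k) = (\<Sum>s\<leftarrow>L k. real (length s + 1))" for k
  proof -
    have "real (\<Sum>s\<leftarrow>l. length s + 1) = (\<Sum>s\<leftarrow>l. real (length s + 1))" for l :: "bool list list"
      by (induction l) simp_all
    then show ?thesis by (simp add: \<tau>_def length_encode)
  qed
  have d: "real_of_int (d k) = (\<Sum>s\<leftarrow>L k. real_of_int (disp s))" for k
  proof -
    have "real_of_int (\<Sum>s\<leftarrow>l. disp s) = (\<Sum>s\<leftarrow>l. real_of_int (disp s))" for l
      by (induction l) simp_all
    then show ?thesis by (simp add: d_def)
  qed
  have lim1: "(\<lambda>k. real (\<tau> k) / real k) \<longlonglongrightarrow> m" using time by (simp add: \<tau>)
  have lim2: "(\<lambda>k. real (\<tau> (Suc k)) / real k) \<longlonglongrightarrow> m"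
  proof -
    have "(\<lambda>k. real (\<tau> (Suc k)) / real (Suc k) * (real (Suc k) / real k)) \<longlonglongrightarrow> m * 1"
      by (intro tendsto_mult LIMSEQ_Suc[OF lim1] LIMSEQ_Suc_n_over_n)
    then show ?thesis by simp
  qed
  have lim3: "(\<lambda>k. \<bar>real_of_int (d k)\<bar> / real k) \<longlonglongrightarrow> 0"
    using tendsto_rabs[OF disp] by (simp add: d abs_divide)
  have k_inf: "filterlim k at_top sequentially" by (rule bounds(5))
  have k_pos: "\<forall>\<^sub>F n in sequentially. 0 < k n"
    by (rule eventually_compose_filterlim[OF eventually_gt_at_top[of 0] k_inf])
  have ratio: "(\<lambda>n. real n / real (k n)) \<longlonglongrightarrow> m"
  proof (rule tendsto_sandwich[OF _ _ filterlim_compose[OF lim1 k_inf] filterlim_compose[OF lim2 k_inf]])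
    show "\<forall>\<^sub>F n in sequentially. real (\<tau> (k n)) / real (k n) \<le> real n / real (k n)"
      using bounds(2) by (intro always_eventually allI divide_right_mono) auto
    show "\<forall>\<^sub>F n in sequentially. real n / real (k n) \<le> real (\<tau> (Suc (k n))) / real (k n)"
      using bounds(3) by (intro always_eventually allI divide_right_mono) (auto intro: less_imp_le)
  qed
  have speed: "(\<lambda>n. real (k n) / real n) \<longlonglongrightarrow> 1 / m"
    using tendsto_inverse[OF ratio] m by (simp add: inverse_eq_divide)
  have "(\<lambda>n. - (real (k n) / real n)) \<longlonglongrightarrow> - (1 / m)"
    by (intro tendsto_minus speed)
  moreover have "- (real (k n) / real n) = (1 / real n) * real_of_int (snd (X n))" for n
    by (simp add: bounds(1))
  ultimately have snd: "(\<lambda>n. (1 / real n) * real_of_int (snd (X n))) \<longlonglongrightarrow> - 1 / m" by simp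
  have fst: "(\<lambda>n. (1 / real n) * real_of_int (fst (X n))) \<longlonglongrightarrow> 0"
  proof (rule Lim_null_comparison)
    have "(\<lambda>n. (\<bar>real_of_int (d (k n))\<bar> / real (k n) + (real (\<tau> (Suc (k n))) / real (k n) - real (\<tau> (k n)) / real (k n))) *
        (real (k n) / real n)) \<longlonglongrightarrow> (0 + (m - m)) * (1 / m)"
      by (intro tendsto_mult tendsto_add tendsto_diff speed filterlim_compose[OF lim1 k_inf]
          filterlim_compose[OF lim2 k_inf] filterlim_compose[OF lim3 k_inf])
    then show "(\<lambda>n. (\<bar>real_of_int (d (k n))\<bar> / real (k n) + (real (\<tau> (Suc (k n))) / real (k n) - real (\<tau> (k n)) / real (k n))) *
        (real (k n) / real n)) \<longlonglongrightarrow> 0" by simp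
    show "\<forall>\<^sub>F n in sequentially. norm ((1 / real n) * real_of_int (fst (X n))) \<le>
        (\<bar>real_of_int (d (k n))\<bar> / real (k n) + (real (\<tau> (Suc (k n))) / real (k n) - real (\<tau> (k n)) / real (k n))) *
        (real (k n) / real n)"
      using k_pos
    proof eventually_elim
      case (elim n)
      have "real_of_int \<bar>fst (X n)\<bar> \<le> real_of_int (\<bar>d (k n)\<bar> + (int (\<tau> (Suc (k n))) - int (\<tau> (k n))))"
        using bounds(4)[of n] by (simp only: of_int_le_iff d_def)
      then have "\<bar>real_of_int (fst (X n))\<bar> / real n \<le>
          (\<bar>real_of_int (d (k n))\<bar> + (real (\<tau> (Suc (k n))) - real (\<tau> (k n)))) / real n"
        by (intro divide_right_mono) auto
      also have "\<dots> = (\<bar>real_of_int (d (k n))\<bar> / real (k n) + (real (\<tau> (Suc (k n))) / real (k n) - real (\<tau> (k n)) / real (k n))) *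
        (real (k n) / real n)"
        using elim by (simp add: add_divide_distrib[symmetric] diff_divide_distrib[symmetric])
      finally show ?case by (simp add: abs_mult)
    qed
  qed
  have "(\<lambda>n. ((1 / real n) * real_of_int (fst (X n)), (1 / real n) * real_of_int (snd (X n)))) \<longlonglongrightarrow> (0, - 1 / m)"
    by (intro tendsto_Pair fst snd)
  then show ?thesis by (simp add: real_site_def)
qed

section \<open>The mean word time and the limiting velocity\<close>

definition mean_time :: "real \<Rightarrow> real" where
  "mean_time p = (\<integral>G. mean_exit (env_row G 0) 0 \<partial>env_law p)"

lemma measurable_mean_exit [measurable]:
  "(\<lambda>G. mean_exit (env_row G y) x) \<in> borel_measurable (env_law p)"
  unfolding mean_exit_def by measurable

lemma integrable_mean_exit: "integrable (env_law p) (\<lambda>G. mean_exit (env_row G y) x)"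
  by (rule integrable_env_law_bounded[OF measurable_mean_exit mean_exit_bounds])

text \<open>The environment average is exchanged with the sum over \<open>n\<close>, dominated by
  \<open>Suc n * (2/3)^n\<close>. This identifies the annealed mean duration of a word with the
  average of the mean exit times in fixed rows.\<close>

lemma exit_law_mean_sums: "(\<lambda>n. real (Suc n) * exit_law p n) sums mean_time p"
proof -
  have "(\<lambda>n. \<integral>G. real (Suc n) * exit_prob (env_row G 0) n 0 \<partial>env_law p) sums
      (\<integral>G. (\<Sum>n. real (Suc n) * exit_prob (env_row G 0) n 0) \<partial>env_law p)"
  proof (rule sums_integral)
    show "integrable (env_law p) (\<lambda>G. real (Suc n) * exit_prob (env_row G 0) n 0)" for n
      by (intro integrable_mult_right integrable_exit_prob)
    show "AE G in env_law p. summable (\<lambda>n. norm (real (Suc n) * exit_prob (env_row G 0) n 0))"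
      using summable_mean_exit by (simp add: exit_prob_nonneg)
    have "norm (real (Suc n) * exit_law p n) \<le> real (Suc n) * (2 / 3) ^ n" for n
      using exit_law_le[of p n] by (simp only: real_norm_def abs_mult abs_of_nonneg[OF exit_law_nonneg] abs_of_nat mult_left_mono of_nat_0_le_iff)
    then have "summable (\<lambda>n. real (Suc n) * exit_law p n)"
      by (intro summable_comparison_test[OF _ sums_summable[OF sums_Suc_geometric[of "2 / 3"]]]) auto
    then show "summable (\<lambda>n. \<integral>G. norm (real (Suc n) * exit_prob (env_row G 0) n 0) \<partial>env_law p)"
      by (simp add: exit_law_def exit_prob_nonneg)
  qed
  then show ?thesis by (simp add: mean_time_def mean_exit_def exit_law_def)
qed

lemma expectation_time: "measure_pmf.expectation (word_pmf p) (\<lambda>s. real (length s + 1)) = mean_time p"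
  using has_bochner_integral_word_pmf[OF _ exit_law_mean_sums] by (simp add: has_bochner_integral_iff)

lemma mean_time_ge_1: "1 \<le> mean_time p"
proof -
  have "1 \<le> mean_exit (env_row G 0) 0" for G
    using mean_exit_eq[of "env_row G 0" 0] mean_exit_bounds(1)[of "env_row G 0"] by (auto intro!: add_nonneg_nonneg)
  then have "(\<integral>G. 1 \<partial>env_law p) \<le> mean_time p"
    unfolding mean_time_def by (intro integral_mono integrable_mean_exit) auto
  then show ?thesis by simp
qed

lemma AE_speed:
  "AE X in annealed_law (three_or_down_pmf p).
    (\<lambda>n. (1 / real n) *\<^sub>R real_site (X n)) \<longlonglongrightarrow> (0, - 1 / mean_time p)"
proof -
  have 1: "\<bar>real (length s + 1)\<bar> \<le> real (length s) + 1" for s :: "bool list" by simp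
  have 2: "\<bar>real_of_int (disp s)\<bar> \<le> real (length s) + 0" for s
    using abs_disp_le[of s] by linarith
  show ?thesis
    using AE_annealed_law_words[of p] AE_word_averages[OF 1 expectation_time[of p]]
      AE_word_averages[OF 2 expectation_disp[of p]]
  proof eventually_elim
    case (elim X)
    from elim(1) obtain L where L: "\<And>k. length (L k) = k" "\<And>k. X \<in> cylinder (encode (L k))" by metis
    show ?case
      by (rule walk_limit[OF L]) (use elim(2,3) L mean_time_ge_1[of p] in auto)
  qed
qed

subsection \<open>The mean time in a row\<close>

lemma measure_three:
  assumes "0 \<le> p" "p \<le> 1"
  shows "measure (three_or_down_pmf p) {three} = p" "measure (three_or_down_pmf p) (- {three}) = 1 - p"
proof -
  have "(\<lambda>b. if b then three else down) -` {three} = {True}"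
  proof (rule set_eqI)
    fix b show "b \<in> (\<lambda>b. if b then three else down) -` {three} \<longleftrightarrow> b \<in> {True}"
      by (cases b) (simp_all add: three_neq_down)
  qed
  then have "measure (three_or_down_pmf p) {three} = measure (bernoulli_pmf p) {True}"
    by (simp only: three_or_down_pmf_def[folded three_def down_def] measure_map_pmf)
  then show 1: "measure (three_or_down_pmf p) {three} = p"
    using assms by (simp add: measure_pmf_single)
  show "measure (three_or_down_pmf p) (- {three}) = 1 - p"
    using measure_pmf.prob_compl[of "{three}" "three_or_down_pmf p"] 1 by (simp add: Compl_eq_Diff_UNIV)
qed

lemma measure_env_law_sites:
  assumes "finite J"
  shows "measure (env_law p) {G. \<forall>z\<in>J. G z \<in> A z} = (\<Prod>z\<in>J. measure (three_or_down_pmf p) (A z))"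
proof -
  interpret product_prob_space "\<lambda>_ :: site. measure_pmf (three_or_down_pmf p)" UNIV ..
  have "{G. \<forall>z\<in>J. G z \<in> A z} = prod_emb UNIV (\<lambda>_. measure_pmf (three_or_down_pmf p)) J (PiE J A)"
    by (auto simp: prod_emb_def PiE_iff simp del: split_paired_All)
  then show ?thesis unfolding env_law_def using assms by (simp add: measure_PiM_emb)
qed

text \<open>For \<open>0 < j < L\<close> the origin lies in a maximal run of three-way sites,
  bounded by down sites at \<open>- j\<close> and \<open>L - j\<close>.\<close>

definition run_event :: "nat \<Rightarrow> nat \<Rightarrow> environment set" where
  "run_event L j = {G. (\<forall>i\<in>{- int j<..<int L - int j}. env_row G 0 i) \<and>
     \<not> env_row G 0 (- int j) \<and> \<not> env_row G 0 (int L - int j)}"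

lemma measure_run_event:
  assumes p: "0 \<le> p" "p \<le> 1" and L: "0 < L"
  shows "measure (env_law p) (run_event L j) = p ^ (L - 1) * (1 - p)\<^sup>2"
proof -
  let ?l = "- int j" and ?r = "int L - int j"
  let ?\<mu> = "measure (three_or_down_pmf p)"
  define A where "A z = (if fst z = ?l \<or> fst z = ?r then - {three} else {three})" for z :: site
  define J where "J = (\<lambda>i. (i, 0 :: int)) ` {?l..?r}"
  have Icc: "{?l..?r} = insert ?l (insert ?r {?l<..<?r})" using L by auto
  have "run_event L j = {G. \<forall>z\<in>J. G z \<in> A z}"
    unfolding J_def Icc run_event_def A_def env_row_def by auto
  moreover have "finite J" by (simp add: J_def)
  ultimately have "measure (env_law p) (run_event L j) = (\<Prod>z\<in>J. ?\<mu> (A z))"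
    by (simp only: measure_env_law_sites)
  also have "\<dots> = (\<Prod>i\<in>{?l..?r}. ?\<mu> (A (i, 0)))"
    unfolding J_def by (subst prod.reindex) (auto simp: inj_on_def)
  also have "\<dots> = (1 - p) * ((1 - p) * (\<Prod>i\<in>{?l<..<?r}. ?\<mu> (A (i, 0))))"
    unfolding Icc using L p by (simp add: A_def measure_three)
  also have "(\<Prod>i\<in>{?l<..<?r}. ?\<mu> (A (i, 0))) = (\<Prod>i\<in>{?l<..<?r}. p)"
    using p by (intro prod.cong) (auto simp: A_def measure_three)
  also have "\<dots> = p ^ (L - 1)" using L by (simp add: nat_diff_distrib)
  finally show ?thesis by (simp add: power2_eq_square)
qed

lemma sets_run_event [measurable]: "run_event L j \<in> sets (env_law p)"
proof -
  have "{G \<in> space (env_law p). (\<forall>i\<in>{- int j<..<int L - int j}. env_row G 0 i) \<and>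
     \<not> env_row G 0 (- int j) \<and> \<not> env_row G 0 (int L - int j)} \<in> sets (env_law p)"
    by measurable
  then show ?thesis by (simp add: run_event_def)
qed

text \<open>The ends are the down sites nearest to the origin on either side. If two candidates
  differed, the nearer one would be a down site inside the other run.\<close>

lemma run_event_disjoint:
  assumes G: "G \<in> run_event L j" "G \<in> run_event L' j'" and j: "0 < j" "j < L" "0 < j'" "j' < L'"
  shows "L = L' \<and> j = j'"
proof -
  have 1: "env_row G 0 i" if "- int j < i" "i < int L - int j" for i
    using G(1) that by (auto simp: run_event_def)
  have 2: "env_row G 0 i" if "- int j' < i" "i < int L' - int j'" for i
    using G(2) that by (auto simp: run_event_def)
  have 3: "\<not> env_row G 0 (- int j)" "\<not> env_row G 0 (int L - int j)" "\<not> env_row G 0 (- int j')" "\<not> env_row G 0 (int L' - int j')"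
    using G by (auto simp: run_event_def)
  have "j = j'" using 1[of "- int j'"] 2[of "- int j"] 3 j by linarith
  moreover have "int L - int j = int L' - int j'"
    using 1[of "int L' - int j'"] 2[of "int L - int j"] 3 j by linarith
  ultimately show ?thesis by simp
qed

definition run_mean :: "nat \<Rightarrow> nat \<Rightarrow> real" where
  "run_mean L j = 3 - 2 * (phi ^ j + phi ^ (L - j)) / (1 + phi ^ L)"

lemma mean_exit_run_event:
  assumes "G \<in> run_event L j" "0 < j" "j < L"
  shows "mean_exit (env_row G 0) 0 = run_mean L j"
  unfolding run_mean_def using assms by (intro mean_exit_run) (auto simp: run_event_def)

text \<open>Environments are split by the run around the origin. A run containing it strictly inside
  has \<open>L \<ge> 2\<close>, hence \<open>L = m + 2\<close> and
  \<open>1 \<le> j \<le> m + 1\<close>. A down site at the origin contributes 1 with probability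
  \<open>1 - p\<close>. Environments not yet covered cost at most 9 times their probability, by
  \<open>mean_exit_bounds\<close>.\<close>

lemma mean_time_sums:
  assumes p: "0 < p" "p < 1"
  shows "(\<lambda>m. \<Sum>j\<in>{1..Suc m}. p ^ Suc m * (1 - p)\<^sup>2 * run_mean (m + 2) j) sums (mean_time p - (1 - p))"
proof -
  interpret prob_space "env_law p" by (rule prob_space_env_law)
  let ?H = "\<lambda>G. mean_exit (env_row G 0) 0"
  define B where "B = {G. \<not> env_row G 0 0}"
  define I where "I n = Sigma {..<n} (\<lambda>m. {1..Suc m})" for n
  define E where "E = (\<lambda>(m, j). run_event (m + 2) j)"
  define U where "U n = B \<union> (\<Union>x\<in>I n. E x)" for n
  have [simp]: "finite (I n)" for n by (simp add: I_def)
  have [measurable]: "B \<in> sets (env_law p)"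
  proof -
    have "{G \<in> space (env_law p). \<not> env_row G 0 0} \<in> sets (env_law p)" by measurable
    then show ?thesis by (simp add: B_def)
  qed
  have [measurable]: "E x \<in> sets (env_law p)" for x by (cases x) (simp add: E_def)
  have [measurable]: "U n \<in> sets (env_law p)" for n
    unfolding U_def by (intro sets.Un sets.finite_UN) auto
  have B_prob: "prob B = 1 - p"
  proof -
    have "B = {G. \<forall>z\<in>{0}. G z \<in> - {three}}" by (auto simp: B_def env_row_def zero_prod_def)
    then show ?thesis using measure_env_law_sites[of "{0}" p "\<lambda>_. - {three}"] p by (simp add: measure_three)
  qed
  have E_prob: "prob (E (m, j)) = p ^ Suc m * (1 - p)\<^sup>2" for m j
    using measure_run_event[of p "m + 2" j] p by (simp add: E_def)
  have E_disj: "disjoint_family_on E (I n)" for n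
    using run_event_disjoint by (fastforce simp: disjoint_family_on_def I_def E_def)
  have B_disj: "B \<inter> (\<Union>x\<in>I n. E x) = {}" for n
    by (auto simp: B_def I_def E_def run_event_def)
  have ind: "indicator (U n) G = indicator B G + (\<Sum>x\<in>I n. indicator (E x) G :: real)" for n G
    unfolding U_def indicator_disj_union[OF B_disj]
    using indicator_UN_disjoint[OF _ E_disj, of n G] by simp
  have bound: "?H G * indicator A G \<le> 9" "0 \<le> ?H G * indicator A G" for A G
    using mean_exit_bounds[of "env_row G 0" 0] by (auto simp: indicator_def)
  have int: "integrable (env_law p) (\<lambda>G. ?H G * indicator A G)" if [measurable]: "A \<in> sets (env_law p)" for A
    by (rule integrable_env_law_bounded[OF _ bound(2,1)]) measurable
  have U_prob: "prob (U n) = (1 - p) + (\<Sum>m<n. real (Suc m) * (p ^ Suc m * (1 - p)\<^sup>2))" for n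
  proof -
    have "prob (U n) = prob B + (\<Sum>x\<in>I n. prob (E x))"
      unfolding U_def using B_disj E_disj
      by (subst finite_measure_Union) (auto intro!: sets.finite_UN finite_measure_finite_Union)
    also have "(\<Sum>x\<in>I n. prob (E x)) = (\<Sum>m<n. \<Sum>j\<in>{1..Suc m}. prob (E (m, j)))"
      unfolding I_def by (subst sum.Sigma) (simp_all add: case_prod_beta)
    finally show ?thesis by (simp add: B_prob E_prob)
  qed
  \<comment> \<open>There are \<open>m + 1\<close> positions for each \<open>m\<close>, so the run
    events have total probability \<open>p\<close>. Together with \<open>B\<close> they exhaust the
    space up to a null set; infinite runs are thereby disposed of.\<close>
  have "(\<lambda>m. p * (1 - p)\<^sup>2 * (real (Suc m) * p ^ m)) sums (p * (1 - p)\<^sup>2 * (1 / (1 - p)\<^sup>2))"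
    using p by (intro sums_mult sums_Suc_geometric) simp
  then have "(\<lambda>m. real (Suc m) * (p ^ Suc m * (1 - p)\<^sup>2)) sums p"
    using p by (simp add: mult_ac)
  then have "(\<lambda>n. prob (U n)) \<longlonglongrightarrow> (1 - p) + p"
    unfolding U_prob sums_def by (intro tendsto_add tendsto_const)
  then have "(\<lambda>n. 9 * (1 - prob (U n))) \<longlonglongrightarrow> 9 * (1 - ((1 - p) + p))"
    by (intro tendsto_mult tendsto_diff tendsto_const)
  then have rest: "(\<lambda>n. 9 * (1 - prob (U n))) \<longlonglongrightarrow> 0" by simp
  have split: "mean_time p - (1 - p) - (\<Sum>m<n. \<Sum>j\<in>{1..Suc m}. p ^ Suc m * (1 - p)\<^sup>2 * run_mean (m + 2) j) =
      (\<integral>G. ?H G * indicator (- U n) G \<partial>env_law p)" for n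
  proof -
    have "?H G * indicator (- U n) G = ?H G - (?H G * indicator B G + (\<Sum>x\<in>I n. ?H G * indicator (E x) G))" for G
      unfolding indicator_compl ind by (simp add: algebra_simps sum_distrib_left)
    then have "(\<integral>G. ?H G * indicator (- U n) G \<partial>env_law p) =
        (\<integral>G. ?H G - (?H G * indicator B G + (\<Sum>x\<in>I n. ?H G * indicator (E x) G)) \<partial>env_law p)"
      by (simp only:)
    also have "\<dots> = mean_time p - (\<integral>G. ?H G * indicator B G + (\<Sum>x\<in>I n. ?H G * indicator (E x) G) \<partial>env_law p)"
      unfolding mean_time_def
      by (intro Bochner_Integration.integral_diff Bochner_Integration.integrable_add
          Bochner_Integration.integrable_sum int integrable_mean_exit) measurable
    also have "(\<integral>G. ?H G * indicator B G + (\<Sum>x\<in>I n. ?H G * indicator (E x) G) \<partial>env_law p) =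
        (\<integral>G. ?H G * indicator B G \<partial>env_law p) + (\<integral>G. (\<Sum>x\<in>I n. ?H G * indicator (E x) G) \<partial>env_law p)"
      by (intro Bochner_Integration.integral_add Bochner_Integration.integrable_sum int) measurable
    also have "(\<integral>G. (\<Sum>x\<in>I n. ?H G * indicator (E x) G) \<partial>env_law p) = (\<Sum>x\<in>I n. \<integral>G. ?H G * indicator (E x) G \<partial>env_law p)"
      by (intro Bochner_Integration.integral_sum int) measurable
    also have "(\<lambda>G. ?H G * indicator B G) = indicator B"
    proof
      fix G show "?H G * indicator B G = indicator B G"
        using mean_exit_eq[of "env_row G 0" 0] by (auto simp: indicator_def B_def)
    qed
    also have "(\<Sum>x\<in>I n. \<integral>G. ?H G * indicator (E x) G \<partial>env_law p) =
        (\<Sum>m<n. \<Sum>j\<in>{1..Suc m}. \<integral>G. ?H G * indicator (E (m, j)) G \<partial>env_law p)"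
      unfolding I_def by (subst sum.Sigma) (simp_all add: case_prod_beta)
    also have "\<dots> = (\<Sum>m<n. \<Sum>j\<in>{1..Suc m}. p ^ Suc m * (1 - p)\<^sup>2 * run_mean (m + 2) j)"
    proof (intro sum.cong refl)
      fix m j assume j: "j \<in> {1..Suc m}"
      have "(\<lambda>G. ?H G * indicator (E (m, j)) G) = (\<lambda>G. run_mean (m + 2) j * indicator (E (m, j)) G)"
        using mean_exit_run_event[of _ "m + 2" j] j by (auto simp: fun_eq_iff indicator_def E_def)
      then show "(\<integral>G. ?H G * indicator (E (m, j)) G \<partial>env_law p) = p ^ Suc m * (1 - p)\<^sup>2 * run_mean (m + 2) j"
        using E_prob[of m j] by simp
    qed
    finally show ?thesis by (simp add: B_prob)
  qed
  have "(\<lambda>n. \<integral>G. ?H G * indicator (- U n) G \<partial>env_law p) \<longlonglongrightarrow> 0"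
  proof (rule tendsto_sandwich[OF _ _ tendsto_const rest])
    show "\<forall>\<^sub>F n in sequentially. 0 \<le> (\<integral>G. ?H G * indicator (- U n) G \<partial>env_law p)"
      using bound by (intro always_eventually allI integral_nonneg_AE) auto
    have compl: "- U n \<in> sets (env_law p)" for n
      using sets.compl_sets[of "U n" "env_law p"] by (simp add: Compl_eq_Diff_UNIV)
    have "(\<integral>G. ?H G * indicator (- U n) G \<partial>env_law p) \<le> 9 * (1 - prob (U n))" for n
    proof -
      have "(\<integral>G. ?H G * indicator (- U n) G \<partial>env_law p) \<le> (\<integral>G. 9 * indicator (- U n) G \<partial>env_law p)"
        using mean_exit_bounds compl[of n]
        by (intro integral_mono int integrable_mult_right integrable_real_indicator)
          (auto intro: mult_right_mono simp: less_top[symmetric])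
      also have "\<dots> = 9 * prob (- U n)" by simp
      finally show ?thesis using prob_compl[of "U n"] by (simp add: Compl_eq_Diff_UNIV)
    qed
    then show "\<forall>\<^sub>F n in sequentially. (\<integral>G. ?H G * indicator (- U n) G \<partial>env_law p) \<le> 9 * (1 - prob (U n))"
      by simp
  qed
  then have "(\<lambda>n. mean_time p - (1 - p) - (\<Sum>m<n. \<Sum>j\<in>{1..Suc m}. p ^ Suc m * (1 - p)\<^sup>2 * run_mean (m + 2) j)) \<longlonglongrightarrow> 0"
    by (simp only: split)
  from tendsto_diff[OF tendsto_const[of "mean_time p - (1 - p)"] this] show ?thesis
    unfolding sums_def by simp
qed

section \<open>Evaluation of the series\<close>

lemma sum_run_mean:
  "(\<Sum>j\<in>{1..Suc m}. run_mean (m + 2) j) =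
    3 * real (Suc m) - 4 / (phi - 1) + 4 * (1 + phi) / (phi - 1) * (1 / (1 + phi ^ (m + 2)))"
proof -
  have phi: "phi - 1 \<noteq> 0" "1 + phi ^ (m + 2) \<noteq> 0"
    using phi_gt_1 add_pos_pos[of 1 "phi ^ (m + 2)"] by auto
  have 1: "(\<Sum>j\<in>{1..Suc m}. phi ^ j) = (phi ^ (m + 2) - phi) / (phi - 1)"
  proof (induction m)
    case (Suc m)
    have "(\<Sum>j\<in>{1..Suc (Suc m)}. phi ^ j) = (phi ^ (m + 2) - phi) / (phi - 1) + phi ^ (m + 2)"
      using Suc by simp
    also have "\<dots> = (phi ^ (Suc m + 2) - phi) / (phi - 1)"
      using phi(1) by (simp add: field_simps)
    finally show ?case .
  qed (use phi in \<open>simp add: field_simps power2_eq_square\<close>)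
  have 2: "(\<Sum>j\<in>{1..Suc m}. phi ^ (m + 2 - j)) = (\<Sum>j\<in>{1..Suc m}. phi ^ j)"
    by (rule sum.reindex_bij_witness[of _ "\<lambda>j. m + 2 - j" "\<lambda>j. m + 2 - j"]) auto
  have "(\<Sum>j\<in>{1..Suc m}. run_mean (m + 2) j) =
      3 * real (Suc m) - 2 * ((\<Sum>j\<in>{1..Suc m}. phi ^ j) + (\<Sum>j\<in>{1..Suc m}. phi ^ (m + 2 - j))) / (1 + phi ^ (m + 2))"
    unfolding run_mean_def sum_subtractf sum_divide_distrib[symmetric] sum_distrib_left[symmetric] sum.distrib
    by simp
  also have "\<dots> = 3 * real (Suc m) - 4 * ((phi ^ (m + 2) - phi) / (phi - 1)) / (1 + phi ^ (m + 2))"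
    unfolding 2 1 by simp
  also have "4 * ((phi ^ (m + 2) - phi) / (phi - 1)) / (1 + phi ^ (m + 2)) =
      4 / (phi - 1) * ((phi ^ (m + 2) - phi) / (1 + phi ^ (m + 2)))" by simp
  also have "(phi ^ (m + 2) - phi) / (1 + phi ^ (m + 2)) = 1 - (1 + phi) * (1 / (1 + phi ^ (m + 2)))"
    using phi(2) by (simp add: field_simps)
  finally show ?thesis by (simp add: algebra_simps)
qed

text \<open>Solving for the series instead of \<open>mean_time\<close> yields its convergence and
  its value at once. The linear part of \<open>sum_run_mean\<close> sums to \<open>3 * p\<close> and
  the constant part to a geometric series.\<close>

lemma mean_time_formula:
  assumes p: "0 < p" "p < 1"
  shows "(\<lambda>m. p ^ (m + 2) / (1 + phi ^ (m + 2))) sums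
    (p / (1 - p)\<^sup>2 * (phi - 1) / (4 * (1 + phi)) * (mean_time p - (1 + 2 * p) + 4 * p * (1 - p) / (phi - 1)))"
proof -
  have phi: "phi - 1 > 0" "1 + phi > 0" using phi_gt_1 by auto
  have "(\<lambda>m. 3 * p * (1 - p)\<^sup>2 * (real (Suc m) * p ^ m)) sums (3 * p * (1 - p)\<^sup>2 * (1 / (1 - p)\<^sup>2))"
    using p by (intro sums_mult sums_Suc_geometric) simp
  then have s1: "(\<lambda>m. 3 * p * (1 - p)\<^sup>2 * (real (Suc m) * p ^ m)) sums (3 * p)" using p by simp
  have aux: "p * c * q * (3 * N - y + z * D) - 3 * p * q * (N * c) + p * q * y * c = p * c * q * z * D"
    for c q N y z D :: real
    by (simp add: algebra_simps)
  have s2': "(\<lambda>m. p * (1 - p)\<^sup>2 * (4 / (phi - 1)) * p ^ m) sums (p * (1 - p)\<^sup>2 * (4 / (phi - 1)) * (1 / (1 - p)))"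
    using p by (intro sums_mult geometric_sums) simp
  have s2: "(\<lambda>m. p * (1 - p)\<^sup>2 * (4 / (phi - 1)) * p ^ m) sums (4 * p * (1 - p) / (phi - 1))"
  proof -
    have "p * (1 - p)\<^sup>2 * (4 / (phi - 1)) * (1 / (1 - p)) = 4 * p * (1 - p) / (phi - 1)"
      using p by (simp add: power2_eq_square)
    with s2' show ?thesis by (simp only:)
  qed
  \<comment> \<open>Cancelling the linear and constant parts termwise leaves only the multiple of
    \<open>1 / (1 + phi ^ (m + 2))\<close>.\<close>
  have "(\<lambda>m. (\<Sum>j\<in>{1..Suc m}. p ^ Suc m * (1 - p)\<^sup>2 * run_mean (m + 2) j)
      - 3 * p * (1 - p)\<^sup>2 * (real (Suc m) * p ^ m) + p * (1 - p)\<^sup>2 * (4 / (phi - 1)) * p ^ m) sums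
      (mean_time p - (1 - p) - 3 * p + 4 * p * (1 - p) / (phi - 1))"
    by (intro sums_add sums_diff mean_time_sums[OF p] s1 s2)
  moreover have "(\<Sum>j\<in>{1..Suc m}. p ^ Suc m * (1 - p)\<^sup>2 * run_mean (m + 2) j)
      - 3 * p * (1 - p)\<^sup>2 * (real (Suc m) * p ^ m) + p * (1 - p)\<^sup>2 * (4 / (phi - 1)) * p ^ m =
      p ^ Suc m * (1 - p)\<^sup>2 * (4 * (1 + phi) / (phi - 1)) * (1 / (1 + phi ^ (m + 2)))" for m
    unfolding sum_distrib_left[symmetric] sum_run_mean power_Suc by (rule aux)
  ultimately have "(\<lambda>m. p ^ Suc m * (1 - p)\<^sup>2 * (4 * (1 + phi) / (phi - 1)) * (1 / (1 + phi ^ (m + 2)))) sums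
      (mean_time p - (1 - p) - 3 * p + 4 * p * (1 - p) / (phi - 1))" by (simp only:)
  then have "(\<lambda>m. p ^ Suc m * (1 - p)\<^sup>2 * (4 * (1 + phi) / (phi - 1)) * (1 / (1 + phi ^ (m + 2)))) sums
      (mean_time p - (1 + 2 * p) + 4 * p * (1 - p) / (phi - 1))"
    by (rule back_subst[where P = "\<lambda>S. _ sums S"]) simp
  \<comment> \<open>The factor is the reciprocal of the coefficient of the series, with one extra
    \<open>p\<close> to raise \<open>p ^ Suc m\<close> to \<open>p ^ (m + 2)\<close>.\<close>
  note scaled = sums_mult[OF this, of "p / (1 - p)\<^sup>2 * (phi - 1) / (4 * (1 + phi))"]
  have cancel: "p / a * b / (4 * c) * (p ^ Suc m * a * (4 * c / b) * (1 / d)) = p ^ (m + 2) / d"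
    if "a \<noteq> 0" "b \<noteq> 0" "c \<noteq> 0" for a b c d m
    using that by simp
  have nz: "(1 - p)\<^sup>2 \<noteq> 0" "phi - 1 \<noteq> 0" "1 + phi \<noteq> 0" using p phi by auto
  show ?thesis using scaled by (simp only: cancel[OF nz])
qed

text \<open>For non-negative terms, ordinary convergence is unconditional, so the shifted series can
  be reindexed along \<open>m + 2\<close>.\<close>

lemma infsum_atLeast_2:
  fixes f :: "nat \<Rightarrow> real"
  assumes "\<And>k. 0 \<le> f k" and "(\<lambda>m. f (m + 2)) sums S"
  shows "(\<Sum>\<^sub>\<infinity>k\<in>{2..}. f k) = S"
proof -
  have "((\<lambda>m. f (m + 2)) has_sum S) UNIV"
    using assms by (intro sums_nonneg_imp_has_sum) auto
  moreover have "bij_betw (\<lambda>m. m + 2) UNIV {2 :: nat..}"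
    by (rule bij_betw_byWitness[of _ "\<lambda>k. k - 2"]) auto
  ultimately have "(f has_sum S) {2..}" using has_sum_reindex_bij_betw[of "\<lambda>m. m + 2" UNIV "{2..}" f S] by simp
  then show ?thesis by (rule infsumI)
qed

theorem mainTheorem6:
  fixes p :: real
  assumes "0 < p" and "p < 1"
  shows "\<exists>v :: real \<times> real.
    measure (annealed_law (three_or_down_pmf p))
      {X \<in> space (annealed_law (three_or_down_pmf p)).
         (\<lambda>n. (1 / real n) *\<^sub>R real_site (X n)) \<longlonglongrightarrow> v} = 1 \<and>
    fst v = 0 \<and> snd v \<noteq> 0 \<and>
    1 / snd v =
      8 * p * (1 - p) / (1 + sqrt 5) - 1 - 2 * p
      - 4 * (1 - p)^2 * (5 + sqrt 5) / (p * (1 + sqrt 5))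
        * (\<Sum>\<^sub>\<infinity>k\<in>{2::nat..}. p^k / (1 + 2 powi (- int k) * (3 + sqrt 5)^k))"
proof -
  let ?M = "annealed_law (three_or_down_pmf p)"
  interpret prob_space ?M by (rule prob_space_annealed_law)
  let ?m = "mean_time p"
  define S where "S = p / (1 - p)\<^sup>2 * (phi - 1) / (4 * (1 + phi)) * (?m - (1 + 2 * p) + 4 * p * (1 - p) / (phi - 1))"
  have m: "?m \<noteq> 0" using mean_time_ge_1[of p] by simp
  have "2 powi (- int k) * (3 + sqrt 5) ^ k = phi ^ k" for k
    unfolding phi_def power_int_minus power_int_of_nat power_divide by (simp only: divide_inverse mult.commute)
  then have "(\<Sum>\<^sub>\<infinity>k\<in>{2::nat..}. p^k / (1 + 2 powi (- int k) * (3 + sqrt 5)^k)) =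
      (\<Sum>\<^sub>\<infinity>k\<in>{2::nat..}. p^k / (1 + phi ^ k))" by simp
  also have "\<dots> = S"
    using mean_time_formula[OF assms] assms phi_gt_1
    by (intro infsum_atLeast_2) (auto simp: S_def)
  finally have sum: "(\<Sum>\<^sub>\<infinity>k\<in>{2::nat..}. p^k / (1 + 2 powi (- int k) * (3 + sqrt 5)^k)) = S" .
  \<comment> \<open>Halving numerator and denominator turns the constants of the statement into
    \<open>1 + phi\<close> and \<open>phi - 1\<close>.\<close>
  have c: "(5 + sqrt 5) / (1 + sqrt 5) = (1 + phi) / (phi - 1)" "8 * p * (1 - p) / (1 + sqrt 5) = 4 * p * (1 - p) / (phi - 1)"
  proof -
    have halve: "8 * p * (1 - p) / x = 4 * p * (1 - p) / (x / 2)" for x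
      by (cases "x = 0") (simp_all add: field_simps)
    have halve': "y / x = (y / 2) / (x / 2)" for x y :: real
      by (cases "x = 0") (simp_all add: field_simps)
    have phi: "1 + phi = (5 + sqrt 5) / 2" "phi - 1 = (1 + sqrt 5) / 2" by (simp_all add: phi_def field_simps)
    show "(5 + sqrt 5) / (1 + sqrt 5) = (1 + phi) / (phi - 1)" unfolding phi by (rule halve')
    show "8 * p * (1 - p) / (1 + sqrt 5) = 4 * p * (1 - p) / (phi - 1)" unfolding phi by (rule halve)
  qed
  have "4 * (1 - p)^2 * (5 + sqrt 5) / (p * (1 + sqrt 5)) * S = 4 * (1 - p)\<^sup>2 / p * ((1 + phi) / (phi - 1)) * S"
    unfolding c(1)[symmetric] by simp
  also have "\<dots> = ?m - (1 + 2 * p) + 4 * p * (1 - p) / (phi - 1)"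
  proof -
    have cancel: "4 * q / p * (c / b) * (p / q * b / (4 * c) * x) = x"
      if "b \<noteq> 0" "c \<noteq> 0" "q \<noteq> 0" for b c q x
      using that assms by simp
    have "phi - 1 \<noteq> 0" "1 + phi \<noteq> 0" "(1 - p)\<^sup>2 \<noteq> 0" using phi_gt_1 assms by auto
    then show ?thesis unfolding S_def by (rule cancel)
  qed
  \<comment> \<open>The series term reproduces \<open>?m\<close> plus exactly the explicit terms,
    which cancel; the right-hand side is the reciprocal of the vertical speed
    \<open>- 1 / ?m\<close>.\<close>
  finally have "8 * p * (1 - p) / (1 + sqrt 5) - 1 - 2 * p
      - 4 * (1 - p)^2 * (5 + sqrt 5) / (p * (1 + sqrt 5)) * S = - ?m"
    unfolding c(2) by simp
  moreover have "prob {X \<in> space ?M. (\<lambda>n. (1 / real n) *\<^sub>R real_site (X n)) \<longlonglongrightarrow> (0, - 1 / ?m)} = 1"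
  proof (subst prob_Collect_eq_1)
    have [measurable]: "(\<lambda>X. f (X n)) \<in> borel_measurable ?M" for f :: "site \<Rightarrow> real \<times> real" and n
      by (subst measurable_cong_sets[OF sets_annealed_law refl])
        (rule measurable_compose[OF measurable_component_singleton[of n]], simp_all)
    show "{X \<in> space ?M. (\<lambda>n. (1 / real n) *\<^sub>R real_site (X n)) \<longlonglongrightarrow> (0, - 1 / ?m)} \<in> events"
      by measurable
  qed (rule AE_speed)
  ultimately show ?thesis
    using m sum by (intro exI[of _ "(0, - 1 / ?m)"]) simp
qed

end
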